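(* Let $1\le r\le\infty$, let $\varphi_X\colon A\to X$ and $\varphi_Y\colon A\to Y$ be maps of directed graphs, and let $X\cup_AY$ be their pushout in the category of directed graphs. If $\varphi_X\colon A\to X$ is an $r$-cofibration, then for $r\le s\le\infty$ the commutative diagram of groupoids $$\begin{array}{ccc} \Pi_1^{s}(A)&\to&\Pi_1^{s}(X)\\ \downarrow&&\downarrow\\ \Pi_1^{s}(Y)&\to&\Pi_1^{s}(X\cup_AY) \end{array}$$ induced by $\varphi_X,\varphi_Y$ and the canonical maps $X\to X\cup_AY$, $Y\to X\cup_AY$ is a pushout.
   Context: A directed graph $X$ consists of a vertex set $V(X)$ and an edge set $E(X)\subset V(X)\times V(X)-\Delta$, where $\Delta$ is the diagonal. A map $f\colon X\to Y$ is a function $V(X)\to V(Y)$ such that for every $(x,y)\in E(X)$ either $(f(x),f(y))\in E(Y)$ or $f(x)=f(y)$; directed graphs and maps form the category of directed graphs. The induced subgraph of $X$ on $W\subset V(X)$ has vertex set $W$ and all edges of $X$ between elements of $W$. For vertices $x,y$ of $X$, $d(x,y)$ is the minimal length $n$ of a sequence $x=x_0,\ldots,x_n=y$ with $(x_i,x_{i+1})\in E(X)$ ($\infty$ if none), and $L(x_0,\ldots,x_n)=\sum_{i=0}^{n-1}d(x_i,x_{i+1})$. For $1\le r<\infty$, $\mathrm{N}^r(X)$ is the simplicial set whose $n$-simplices are the tuples $(x_0,\ldots,x_n)\in V(X)^{n+1}$ with $L(x_0,\ldots,x_n)\le r$, with faces deleting and degeneracies repeating entries; $\mathrm{N}^\infty(X)$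 is defined likewise with $L<\infty$. The $r$-fundamental groupoid $\Pi_1^r(X)$, $1\le r\le\infty$, is the edge-path groupoid of $\mathrm{N}^r(X)$: objects are the vertices of $X$, and it is generated by the $1$-simplices $(x,y)$ (as morphisms $x\to y$) subject to $(x,x)=1_x$ and, for each $2$-simplex $(x,y,z)$, that $(x,z)$ equals $(x,y)$ followed by $(y,z)$. It is functorial for maps. For a subgraph $A$ of $X$, the reach $\mathrm{r}(A)$ is the set of all vertices $x$ of $X$ admitting a directed path from some vertex of $A$ (i.e. $d(a,x)<\infty$ for some $a\in V(A)$). For $1\le r<\infty$, an $r$-cofibration is an induced subgraph inclusion $A\to X$ such that (with $d$ taken in $X$) (1) $d(x,a)=\infty$ for any $x\in V(X)-V(A)$ and $a\in V(A)$; and (2) there is a function $\pi\colon\mathrm{r}(A)\to V(A)$ such that for any $a\in V(A)$ and $x\in\mathrm{r}(A)$: $d(a,\pi(x))\le d(a,x)$; $d(a,\pi(x))+d(\pi(x),x)\le r$ if $d(a,x)\le r$; and $d(a,\pi(x))+d(\pi(x),x)=d(a,x)$ if $d(a,x)>r$. An $\infty$-cofibration is an induced subgraph inclusion $A\to X$ satisfying (1) and such that there is a function $\pi\colon\mathrm{r}(A)\to V(A)$ such that for any $a\in V(A)$ and $x\in\mathrm{r}(A)$, $d(a,x)<\infty$ if and only if $d(a,\pi(x))<\infty$. *)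

theory Defs
  imports "Graph_Theory.Digraph_Component" "HOL-Library.Extended_Nat"
begin

section \<open>Directed graphs\<close>

text \<open>
  A directed graph is a \<open>pair_pre_digraph\<close> satisfying \<open>pair_loopfree_digraph\<close>: the arcs are
  ordered pairs of distinct vertices, and no finiteness is assumed. A map is a total function of
  which only the values on the vertex set matter; it may contract arcs.
\<close>

definition digraph_map :: "'a pair_pre_digraph \<Rightarrow> 'b pair_pre_digraph \<Rightarrow> ('a \<Rightarrow> 'b) \<Rightarrow> bool" where
  "digraph_map X Y f \<longleftrightarrow>
     (\<forall>x\<in>pverts X. f x \<in> pverts Y) \<and>
     (\<forall>x y. (x, y) \<in> parcs X \<longrightarrow> (f x, f y) \<in> parcs Y \<or> f x = f y)"

text \<open>The infimum of the empty set in \<^typ>\<open>enat\<close> is \<open>\<infinity>\<close>.\<close>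

definition ddist :: "'a pair_pre_digraph \<Rightarrow> 'a \<Rightarrow> 'a \<Rightarrow> enat" where
  "ddist X x y = (INF n\<in>{n. (x, y) \<in> parcs X ^^ n}. enat n)"

definition tuple_length :: "'a pair_pre_digraph \<Rightarrow> 'a list \<Rightarrow> enat" where
  "tuple_length X xs = (\<Sum>i<length xs - 1. ddist X (xs ! i) (xs ! Suc i))"

definition reach :: "'a pair_pre_digraph \<Rightarrow> 'a pair_pre_digraph \<Rightarrow> 'a set" where
  "reach X A = {x \<in> pverts X. \<exists>a\<in>pverts A. ddist X a x < \<infinity>}"

text \<open>
  Since \<open>A\<close> is literally a subgraph of \<open>X\<close>, the inclusion is a function that is the
  identity on the vertices of \<open>A\<close>.
\<close>

definition cofibration ::
    "enat \<Rightarrow> 'a pair_pre_digraph \<Rightarrow> 'a pair_pre_digraph \<Rightarrow> ('a \<Rightarrow> 'a) \<Rightarrow> bool" where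
  "cofibration r A X \<phi> \<longleftrightarrow>
     induced_subgraph (with_proj A) (with_proj X) \<and>
     (\<forall>a\<in>pverts A. \<phi> a = a) \<and>
     (\<forall>x\<in>pverts X - pverts A. \<forall>a\<in>pverts A. ddist X x a = \<infinity>) \<and>
     (\<exists>\<pi>. (\<forall>x\<in>reach X A. \<pi> x \<in> pverts A) \<and>
       (\<forall>a\<in>pverts A. \<forall>x\<in>reach X A.
         if r = \<infinity> then ddist X a x < \<infinity> \<longleftrightarrow> ddist X a (\<pi> x) < \<infinity>
         else ddist X a (\<pi> x) \<le> ddist X a x \<and>
              (ddist X a x \<le> r \<longrightarrow> ddist X a (\<pi> x) + ddist X (\<pi> x) x \<le> r) \<and>
              (ddist X a x > r \<longrightarrow> ddist X a (\<pi> x) + ddist X (\<pi> x) x = ddist X a x)))"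


section \<open>Pushouts of directed graphs\<close>

text \<open>
  The vertices are the classes of the disjoint union of the two vertex sets under the
  equivalence relation generated by \<open>f a \<sim> g a\<close>; arcs that become loops are dropped.
  The universal property is the lemma \<open>pushout_graph_is_pushout\<close> below.
\<close>

definition glue :: "'a pair_pre_digraph \<Rightarrow> ('a \<Rightarrow> 'x) \<Rightarrow> ('a \<Rightarrow> 'y) \<Rightarrow> 'x + 'y \<Rightarrow> 'x + 'y \<Rightarrow> bool" where
  "glue A f g = equivclp (\<lambda>p q. \<exists>a\<in>pverts A. p = Inl (f a) \<and> q = Inr (g a))"

definition pushout_inl :: "'a pair_pre_digraph \<Rightarrow> ('a \<Rightarrow> 'x) \<Rightarrow> ('a \<Rightarrow> 'y) \<Rightarrow> 'x \<Rightarrow> ('x + 'y) set" where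
  "pushout_inl A f g x = {p. glue A f g (Inl x) p}"

definition pushout_inr :: "'a pair_pre_digraph \<Rightarrow> ('a \<Rightarrow> 'x) \<Rightarrow> ('a \<Rightarrow> 'y) \<Rightarrow> 'y \<Rightarrow> ('x + 'y) set" where
  "pushout_inr A f g y = {p. glue A f g (Inr y) p}"

definition pushout_graph ::
    "'a pair_pre_digraph \<Rightarrow> 'x pair_pre_digraph \<Rightarrow> 'y pair_pre_digraph \<Rightarrow>
     ('a \<Rightarrow> 'x) \<Rightarrow> ('a \<Rightarrow> 'y) \<Rightarrow> ('x + 'y) set pair_pre_digraph" where
  "pushout_graph A X Y f g =
     \<lparr> pverts = pushout_inl A f g ` pverts X \<union> pushout_inr A f g ` pverts Y,
       parcs = (map_prod (pushout_inl A f g) (pushout_inl A f g) ` parcs X \<union>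
                map_prod (pushout_inr A f g) (pushout_inr A f g) ` parcs Y) - Id \<rparr>"

lemma pushout_inl_eq_iff: "pushout_inl A f g x = pushout_inl A f g x' \<longleftrightarrow> glue A f g (Inl x) (Inl x')"
  and pushout_inr_eq_iff: "pushout_inr A f g y = pushout_inr A f g y' \<longleftrightarrow> glue A f g (Inr y) (Inr y')"
  and pushout_inl_inr_eq_iff: "pushout_inl A f g x = pushout_inr A f g y \<longleftrightarrow> glue A f g (Inl x) (Inr y)"
  unfolding pushout_inl_def pushout_inr_def glue_def set_eq_iff mem_Collect_eq
  by (meson equivclp_refl equivclp_sym equivclp_trans)+

lemma pushout_graph_is_pushout:
  fixes A :: "'a pair_pre_digraph" and X :: "'x pair_pre_digraph" and Y :: "'y pair_pre_digraph"
    and Z :: "'z pair_pre_digraph"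
  assumes A: "pair_loopfree_digraph A" and X: "pair_loopfree_digraph X" and Y: "pair_loopfree_digraph Y"
    and f: "digraph_map A X f" and g: "digraph_map A Y g"
  defines "P \<equiv> pushout_graph A X Y f g"
    and "i \<equiv> pushout_inl A f g" and "j \<equiv> pushout_inr A f g"
  shows "pair_loopfree_digraph P" "digraph_map X P i" "digraph_map Y P j"
    "\<forall>a\<in>pverts A. i (f a) = j (g a)"
    "\<lbrakk> pair_loopfree_digraph Z; digraph_map X Z h; digraph_map Y Z k;
       \<forall>a\<in>pverts A. h (f a) = k (g a) \<rbrakk> \<Longrightarrow>
     \<exists>u. digraph_map P Z u \<and> (\<forall>x\<in>pverts X. u (i x) = h x) \<and> (\<forall>y\<in>pverts Y. u (j y) = k y) \<and>
       (\<forall>u'. digraph_map P Z u' \<longrightarrow> (\<forall>x\<in>pverts X. u' (i x) = h x) \<longrightarrow>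
          (\<forall>y\<in>pverts Y. u' (j y) = k y) \<longrightarrow> (\<forall>p\<in>pverts P. u' p = u p))"
proof -
  interpret X: pair_loopfree_digraph X by fact
  interpret Y: pair_loopfree_digraph Y by fact
  show "pair_loopfree_digraph P"
    by unfold_locales
      (auto simp: P_def pushout_graph_def dest: X.wellformed' Y.wellformed')
  show "digraph_map X P i" "digraph_map Y P j"
    unfolding digraph_map_def P_def pushout_graph_def i_def j_def by force+
  show "\<forall>a\<in>pverts A. i (f a) = j (g a)"
    unfolding i_def j_def pushout_inl_inr_eq_iff glue_def by (auto intro!: r_into_equivclp)
next
  assume Z: "pair_loopfree_digraph Z" and h: "digraph_map X Z h" and k: "digraph_map Y Z k"
    and hk: "\<forall>a\<in>pverts A. h (f a) = k (g a)"
  have inv: "case_sum h k p = case_sum h k q" if "glue A f g p q" for p q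
    using that unfolding glue_def by (induction rule: equivclp_induct) (use hk in auto)
  define u where "u c = case_sum h k (SOME p. p \<in> c)" for c
  have ui: "u (i x) = h x" for x
  proof -
    have "glue A f g (Inl x) (SOME p. p \<in> i x)"
      by (rule someI2[of _ "Inl x"]) (auto simp: i_def pushout_inl_def glue_def)
    from inv[OF this] show ?thesis by (simp add: u_def)
  qed
  have uj: "u (j y) = k y" for y
  proof -
    have "glue A f g (Inr y) (SOME p. p \<in> j y)"
      by (rule someI2[of _ "Inr y"]) (auto simp: j_def pushout_inr_def glue_def)
    from inv[OF this] show ?thesis by (simp add: u_def)
  qed
  have "digraph_map P Z u"
    using h k unfolding digraph_map_def P_def pushout_graph_def i_def[symmetric] j_def[symmetric]
    by (fastforce simp: ui uj)
  moreover have "u' p = u p"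
    if "\<forall>x\<in>pverts X. u' (i x) = h x" "\<forall>y\<in>pverts Y. u' (j y) = k y" "p \<in> pverts P" for u' p
    using that unfolding P_def pushout_graph_def i_def[symmetric] j_def[symmetric]
    by (auto simp: ui uj)
  ultimately show "\<exists>u. digraph_map P Z u \<and> (\<forall>x\<in>pverts X. u (i x) = h x) \<and> (\<forall>y\<in>pverts Y. u (j y) = k y) \<and>
       (\<forall>u'. digraph_map P Z u' \<longrightarrow> (\<forall>x\<in>pverts X. u' (i x) = h x) \<longrightarrow>
          (\<forall>y\<in>pverts Y. u' (j y) = k y) \<longrightarrow> (\<forall>p\<in>pverts P. u' p = u p))"
    using ui uj by (intro exI[of _ u]) blast
qed


section \<open>Groupoids\<close>

text \<open>Composition is written in diagrammatic order: \<open>Comp G f g\<close> is \<open>f\<close> followed by \<open>g\<close>.\<close>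

record ('o, 'm) gpd =
  Ob :: "'o set"
  Ar :: "'m set"
  Dom :: "'m \<Rightarrow> 'o"
  Cod :: "'m \<Rightarrow> 'o"
  Id :: "'o \<Rightarrow> 'm"
  Comp :: "'m \<Rightarrow> 'm \<Rightarrow> 'm"

hide_const (open) Id

locale groupoid =
  fixes G :: "('o, 'm) gpd"
  assumes Dom_in: "f \<in> Ar G \<Longrightarrow> Dom G f \<in> Ob G"
    and Cod_in: "f \<in> Ar G \<Longrightarrow> Cod G f \<in> Ob G"
    and Id_in: "x \<in> Ob G \<Longrightarrow> gpd.Id G x \<in> Ar G"
    and Dom_Id: "x \<in> Ob G \<Longrightarrow> Dom G (gpd.Id G x) = x"
    and Cod_Id: "x \<in> Ob G \<Longrightarrow> Cod G (gpd.Id G x) = x"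
    and Comp_in: "\<lbrakk> f \<in> Ar G; g \<in> Ar G; Cod G f = Dom G g \<rbrakk> \<Longrightarrow> Comp G f g \<in> Ar G"
    and Dom_Comp: "\<lbrakk> f \<in> Ar G; g \<in> Ar G; Cod G f = Dom G g \<rbrakk> \<Longrightarrow> Dom G (Comp G f g) = Dom G f"
    and Cod_Comp: "\<lbrakk> f \<in> Ar G; g \<in> Ar G; Cod G f = Dom G g \<rbrakk> \<Longrightarrow> Cod G (Comp G f g) = Cod G g"
    and Id_Comp: "f \<in> Ar G \<Longrightarrow> Comp G (gpd.Id G (Dom G f)) f = f"
    and Comp_Id: "f \<in> Ar G \<Longrightarrow> Comp G f (gpd.Id G (Cod G f)) = f"
    and Comp_assoc: "\<lbrakk> f \<in> Ar G; g \<in> Ar G; h \<in> Ar G; Cod G f = Dom G g; Cod G g = Dom G h \<rbrakk>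
      \<Longrightarrow> Comp G (Comp G f g) h = Comp G f (Comp G g h)"
    and ex_inverse: "f \<in> Ar G \<Longrightarrow> \<exists>g\<in>Ar G. Dom G g = Cod G f \<and> Cod G g = Dom G f \<and>
      Comp G f g = gpd.Id G (Dom G f) \<and> Comp G g f = gpd.Id G (Cod G f)"

record ('o, 'm, 'p, 'n) gpd_map =
  on_Ob :: "'o \<Rightarrow> 'p"
  on_Ar :: "'m \<Rightarrow> 'n"

locale groupoid_functor = G: groupoid G + H: groupoid H
  for G :: "('o, 'm) gpd" and H :: "('p, 'n) gpd" +
  fixes F :: "('o, 'm, 'p, 'n) gpd_map"
  assumes on_Ob_in: "x \<in> Ob G \<Longrightarrow> on_Ob F x \<in> Ob H"
    and on_Ar_in: "f \<in> Ar G \<Longrightarrow> on_Ar F f \<in> Ar H"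
    and on_Ar_Dom: "f \<in> Ar G \<Longrightarrow> Dom H (on_Ar F f) = on_Ob F (Dom G f)"
    and on_Ar_Cod: "f \<in> Ar G \<Longrightarrow> Cod H (on_Ar F f) = on_Ob F (Cod G f)"
    and on_Ar_Id: "x \<in> Ob G \<Longrightarrow> on_Ar F (gpd.Id G x) = gpd.Id H (on_Ob F x)"
    and on_Ar_Comp: "\<lbrakk> f \<in> Ar G; g \<in> Ar G; Cod G f = Dom G g \<rbrakk>
      \<Longrightarrow> on_Ar F (Comp G f g) = Comp H (on_Ar F f) (on_Ar F g)"

definition gpd_comp ::
    "('p, 'n, 'q, 'k) gpd_map \<Rightarrow> ('o, 'm, 'p, 'n) gpd_map \<Rightarrow> ('o, 'm, 'q, 'k) gpd_map" where
  "gpd_comp K F = \<lparr> on_Ob = on_Ob K \<circ> on_Ob F, on_Ar = on_Ar K \<circ> on_Ar F \<rparr>"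

text \<open>Functors are total functions in HOL, so they are compared on objects and arrows of the source.\<close>

definition gpd_map_eq ::
    "('o, 'm) gpd \<Rightarrow> ('o, 'm, 'p, 'n) gpd_map \<Rightarrow> ('o, 'm, 'p, 'n) gpd_map \<Rightarrow> bool" where
  "gpd_map_eq G F F' \<longleftrightarrow>
     (\<forall>x\<in>Ob G. on_Ob F x = on_Ob F' x) \<and> (\<forall>f\<in>Ar G. on_Ar F f = on_Ar F' f)"

text \<open>
  The square with legs \<open>F : GA \<rightarrow> GX\<close>, \<open>G : GA \<rightarrow> GY\<close>, \<open>I : GX \<rightarrow> GP\<close>, \<open>J : GY \<rightarrow> GP\<close> is a
  pushout in the category of groupoids (strict commutativity and uniqueness). HOL cannot quantify
  over types inside a formula, so the types of objects and arrows of the test groupoids are the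
  explicit type argument; a theorem in which this argument is a type variable quantifies over all
  test groupoids.
\<close>

definition groupoid_pushout ::
    "('t \<times> 'u) itself \<Rightarrow> ('a, 'am) gpd \<Rightarrow> ('x, 'xm) gpd \<Rightarrow> ('y, 'ym) gpd \<Rightarrow> ('p, 'pm) gpd \<Rightarrow>
     ('a, 'am, 'x, 'xm) gpd_map \<Rightarrow> ('a, 'am, 'y, 'ym) gpd_map \<Rightarrow>
     ('x, 'xm, 'p, 'pm) gpd_map \<Rightarrow> ('y, 'ym, 'p, 'pm) gpd_map \<Rightarrow> bool" where
  "groupoid_pushout T GA GX GY GP F G I J \<longleftrightarrow>
     groupoid_functor GA GX F \<and> groupoid_functor GA GY G \<and>
     groupoid_functor GX GP I \<and> groupoid_functor GY GP J \<and>
     gpd_map_eq GA (gpd_comp I F) (gpd_comp J G) \<and>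
     (\<forall>(H :: ('t, 'u) gpd) K M.
        groupoid_functor GX H K \<and> groupoid_functor GY H M \<and>
        gpd_map_eq GA (gpd_comp K F) (gpd_comp M G) \<longrightarrow>
        (\<exists>U. groupoid_functor GP H U \<and>
           gpd_map_eq GX (gpd_comp U I) K \<and> gpd_map_eq GY (gpd_comp U J) M \<and>
           (\<forall>U'. groupoid_functor GP H U' \<and>
              gpd_map_eq GX (gpd_comp U' I) K \<and> gpd_map_eq GY (gpd_comp U' J) M \<longrightarrow>
              gpd_map_eq GP U' U)))"


section \<open>The nerve and its edge-path groupoid\<close>

text \<open>
  \<open>nerve r X n\<close> is the set of \<open>n\<close>-simplices, as lists of length \<open>n + 1\<close>; faces delete
  entries and degeneracies repeat entries. For \<open>r = \<infinity>\<close> the bound is strict.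
\<close>

definition nerve :: "enat \<Rightarrow> 'a pair_pre_digraph \<Rightarrow> nat \<Rightarrow> 'a list set" where
  "nerve r X n = {xs. length xs = Suc n \<and> set xs \<subseteq> pverts X \<and>
     (if r = \<infinity> then tuple_length X xs < \<infinity> else tuple_length X xs \<le> r)}"

text \<open>
  In this section \<open>S\<close> is a simplicial set of tuples, given by its sets of \<open>n\<close>-simplices. The
  edge-path groupoid is built from words in the 1-simplices \<open>(x, y)\<close> (\<open>Fwd x y : x \<rightarrow> y\<close>) and
  their formal inverses (\<open>Bwd x y : y \<rightarrow> x\<close>); \<open>ep_word S a w b\<close> says that \<open>w\<close> is a
  composable word from \<open>a\<close> to \<open>b\<close>.
\<close>

datatype 'a edge = Fwd 'a 'a | Bwd 'a 'a

fun ep_word :: "(nat \<Rightarrow> 'a list set) \<Rightarrow> 'a \<Rightarrow> 'a edge list \<Rightarrow> 'a \<Rightarrow> bool" where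
  "ep_word S a [] b \<longleftrightarrow> a = b \<and> [a] \<in> S 0"
| "ep_word S a (Fwd x y # w) b \<longleftrightarrow> a = x \<and> [x, y] \<in> S 1 \<and> ep_word S y w b"
| "ep_word S a (Bwd x y # w) b \<longleftrightarrow> a = y \<and> [x, y] \<in> S 1 \<and> ep_word S x w b"

inductive ep_equiv :: "(nat \<Rightarrow> 'a list set) \<Rightarrow> 'a \<Rightarrow> 'a \<Rightarrow> 'a edge list \<Rightarrow> 'a edge list \<Rightarrow> bool"
  for S a b where
  refl: "ep_word S a w b \<Longrightarrow> ep_equiv S a b w w"
| sym: "ep_equiv S a b w w' \<Longrightarrow> ep_equiv S a b w' w"
| trans: "\<lbrakk> ep_equiv S a b w w'; ep_equiv S a b w' w'' \<rbrakk> \<Longrightarrow> ep_equiv S a b w w''"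
| right_inverse: "ep_word S a (u @ [Fwd x y, Bwd x y] @ v) b \<Longrightarrow>
    ep_equiv S a b (u @ [Fwd x y, Bwd x y] @ v) (u @ v)"
| left_inverse: "ep_word S a (u @ [Bwd x y, Fwd x y] @ v) b \<Longrightarrow>
    ep_equiv S a b (u @ [Bwd x y, Fwd x y] @ v) (u @ v)"
| degenerate: "ep_word S a (u @ [Fwd x x] @ v) b \<Longrightarrow>
    ep_equiv S a b (u @ [Fwd x x] @ v) (u @ v)"
| triangle: "\<lbrakk> [x, y, z] \<in> S 2; ep_word S a (u @ [Fwd x z] @ v) b \<rbrakk> \<Longrightarrow>
    ep_equiv S a b (u @ [Fwd x z] @ v) (u @ [Fwd x y, Fwd y z] @ v)"

text \<open>An arrow is a triple consisting of its source, an equivalence class of words, and its target.\<close>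

definition edge_path_groupoid ::
    "(nat \<Rightarrow> 'a list set) \<Rightarrow> ('a, 'a \<times> 'a edge list set \<times> 'a) gpd" where
  "edge_path_groupoid S =
     \<lparr> Ob = {x. [x] \<in> S 0},
       Ar = {(x, {w'. ep_equiv S x y w w'}, y) | x w y. ep_word S x w y},
       Dom = (\<lambda>(x, C, y). x),
       Cod = (\<lambda>(x, C, y). y),
       Id = (\<lambda>x. (x, {w. ep_equiv S x x [] w}, x)),
       Comp = (\<lambda>(x, C, y) (y', D, z). (x, {w. \<exists>u\<in>C. \<exists>v\<in>D. ep_equiv S x z (u @ v) w}, z)) \<rparr>"

definition fundamental_groupoid ::
    "enat \<Rightarrow> 'a pair_pre_digraph \<Rightarrow> ('a, 'a \<times> 'a edge list set \<times> 'a) gpd" ("\<Pi>\<^sub>1") where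
  "\<Pi>\<^sub>1 r X = edge_path_groupoid (nerve r X)"

text \<open>
  The functor induced by a map \<open>f : X \<rightarrow> Y\<close>, sending a generator \<open>(x, y)\<close> to \<open>(f x, f y)\<close>.
\<close>

definition fundamental_groupoid_map ::
    "enat \<Rightarrow> 'b pair_pre_digraph \<Rightarrow> ('a \<Rightarrow> 'b) \<Rightarrow>
     ('a, 'a \<times> 'a edge list set \<times> 'a, 'b, 'b \<times> 'b edge list set \<times> 'b) gpd_map" ("\<Pi>\<^sub>1map") where
  "\<Pi>\<^sub>1map r Y f =
     \<lparr> on_Ob = f,
       on_Ar = (\<lambda>(x, C, y).
         (f x, {w'. \<exists>w\<in>C. ep_equiv (nerve r Y) (f x) (f y) (map (map_edge f) w) w'}, f y)) \<rparr>"

end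

theory Submission
  imports Defs
begin

text \<open>
  Why the square is a pushout. An edge-path groupoid is presented by generators and relations, so
  a functor out of it is the same as an assignment of arrows to the 1-simplices that respects
  degenerate 1-simplices and 2-simplices (\<open>generator_assignment\<close>), and it is determined by that
  assignment (\<open>functor_eqI\<close>). Everything thus reduces to 1- and 2-simplices of the nerve of the
  pushout graph \<open>P\<close>.

  No arc of \<open>X\<close> enters \<open>A\<close> from outside. Hence the vertices of \<open>P\<close> are those of \<open>Y\<close> together with
  those of \<open>X - A\<close>, a directed path in \<open>P\<close> can leave \<open>Y\<close> only once, through a vertex of \<open>A\<close>, and
  cannot return. So distances inside \<open>Y\<close> and inside \<open>X - A\<close> do not change, there is no path from
  \<open>X - A\<close> to \<open>Y\<close>, and a finite distance from \<open>y\<close> to \<open>x\<close> is \<open>d(y, g a) + d(a, x)\<close> for a suitable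
  \<open>a\<close> in \<open>A\<close>, where \<open>g\<close> is the map from \<open>A\<close> to \<open>Y\<close>.

  Let functors \<open>K\<close> on the groupoid of \<open>X\<close> and \<open>M\<close> on that of \<open>Y\<close> agree on \<open>A\<close>. A 1-simplex \<open>(y, x)\<close>
  of \<open>P\<close> from \<open>Y\<close> to \<open>X - A\<close> spans a 2-simplex with a vertex \<open>a\<close> of \<open>A\<close> on a shortest path, so an
  extension of \<open>K\<close> and \<open>M\<close> must send it to \<open>M(y, g a) K(a, x)\<close>. This gives uniqueness. For existence
  one needs independence of \<open>a\<close>, and this is the purpose of the cofibration: its retraction \<open>\<pi>\<close>
  makes \<open>(a, \<pi> x, x)\<close> and \<open>(y, g a, g (\<pi> x))\<close> 2-simplices, whence
  \<open>M(y, g a) K(a, x) = M(y, g a) K(a, \<pi> x) K(\<pi> x, x) = M(y, g (\<pi> x)) K(\<pi> x, x)\<close>,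
  an expression without \<open>a\<close> (\<open>cross_independent\<close>). The relation of a 2-simplex of \<open>P\<close> then follows
  by choosing the vertex \<open>a\<close> that is convenient for it (\<open>glued_generator_triangle\<close>).
\<close>

section \<open>Groupoids and functors\<close>

lemma (in groupoid) left_cancel:
  assumes f: "f \<in> Ar G" and g: "g \<in> Ar G" "Dom G g = Cod G f"
    and h: "h \<in> Ar G" "Dom G h = Cod G f" and eq: "Comp G f g = Comp G f h"
  shows "g = h"
proof -
  obtain k where k: "k \<in> Ar G" "Dom G k = Cod G f" "Cod G k = Dom G f"
    "Comp G k f = gpd.Id G (Cod G f)"
    using ex_inverse[OF f] by blast
  have "g = Comp G (Comp G k f) g"
    using Id_Comp[OF g(1)] g k by simp
  also have "\<dots> = Comp G k (Comp G f g)"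
    by (rule Comp_assoc) (use f g k in auto)
  also have "\<dots> = Comp G k (Comp G f h)"
    by (simp add: eq)
  also have "\<dots> = Comp G (Comp G k f) h"
    by (rule Comp_assoc[symmetric]) (use f h k in auto)
  also have "\<dots> = h"
    using Id_Comp[OF h(1)] h k by simp
  finally show ?thesis .
qed

definition gpd_inverse :: "('o, 'm) gpd \<Rightarrow> 'm \<Rightarrow> 'm" where
  "gpd_inverse G f = (SOME g. g \<in> Ar G \<and> Dom G g = Cod G f \<and> Cod G g = Dom G f \<and>
      Comp G f g = gpd.Id G (Dom G f) \<and> Comp G g f = gpd.Id G (Cod G f))"

lemma (in groupoid) gpd_inverse:
  assumes "f \<in> Ar G"
  shows "gpd_inverse G f \<in> Ar G" "Dom G (gpd_inverse G f) = Cod G f"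
    "Cod G (gpd_inverse G f) = Dom G f"
    "Comp G f (gpd_inverse G f) = gpd.Id G (Dom G f)"
    "Comp G (gpd_inverse G f) f = gpd.Id G (Cod G f)"
proof -
  have "\<exists>g. g \<in> Ar G \<and> Dom G g = Cod G f \<and> Cod G g = Dom G f \<and>
      Comp G f g = gpd.Id G (Dom G f) \<and> Comp G g f = gpd.Id G (Cod G f)"
    using ex_inverse[OF assms] by blast
  from someI_ex[OF this] show "gpd_inverse G f \<in> Ar G" "Dom G (gpd_inverse G f) = Cod G f"
    "Cod G (gpd_inverse G f) = Dom G f"
    "Comp G f (gpd_inverse G f) = gpd.Id G (Dom G f)"
    "Comp G (gpd_inverse G f) f = gpd.Id G (Cod G f)"
    unfolding gpd_inverse_def by blast+
qed

lemma groupoid_functor_gpd_comp: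
  assumes "groupoid_functor G H F" "groupoid_functor H K E"
  shows "groupoid_functor G K (gpd_comp E F)"
proof -
  interpret F: groupoid_functor G H F by fact
  interpret E: groupoid_functor H K E by fact
  show ?thesis
    by unfold_locales
      (simp_all add: gpd_comp_def F.on_Ob_in F.on_Ar_in F.on_Ar_Dom F.on_Ar_Cod F.on_Ar_Id
        F.on_Ar_Comp E.on_Ob_in E.on_Ar_in E.on_Ar_Dom E.on_Ar_Cod E.on_Ar_Id E.on_Ar_Comp)
qed

section \<open>Words and their classes in an edge-path groupoid\<close>

text \<open>
  The part of the simplicial structure of a complex of tuples that its edge-path groupoid sees:
  faces of simplices of dimension at most 2, and degenerate 1-simplices.
\<close>
locale tuple_complex =
  fixes S :: "nat \<Rightarrow> 'a list set"
  assumes edge_vertices: "[x, y] \<in> S (Suc 0) \<Longrightarrow> [x] \<in> S 0 \<and> [y] \<in> S 0"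
    and loop_edge: "[x] \<in> S 0 \<Longrightarrow> [x, x] \<in> S (Suc 0)"
    and triangle_edges: "[x, y, z] \<in> S 2 \<Longrightarrow> [x, y] \<in> S (Suc 0) \<and> [y, z] \<in> S (Suc 0) \<and> [x, z] \<in> S (Suc 0)"
begin

lemma ep_word_vertices: "ep_word S a w b \<Longrightarrow> [a] \<in> S 0 \<and> [b] \<in> S 0"
proof (induction w arbitrary: a)
  case (Cons e w)
  then show ?case by (cases e) (auto dest: edge_vertices)
qed auto

lemma ep_word_append: "ep_word S a (u @ v) b \<longleftrightarrow> (\<exists>c. ep_word S a u c \<and> ep_word S c v b)"
proof (induction u arbitrary: a)
  case Nil
  then show ?case by (auto dest: ep_word_vertices)
next
  case (Cons e u)
  then show ?case by (cases e) auto
qed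

lemma ep_word_Fwd: "ep_word S x [Fwd x y] y \<longleftrightarrow> [x, y] \<in> S (Suc 0)"
  by (auto dest: edge_vertices)

lemma ep_equiv_words: "ep_equiv S a b w w' \<Longrightarrow> ep_word S a w b \<and> ep_word S a w' b"
proof (induction rule: ep_equiv.induct)
  case (triangle x y z u v)
  then show ?case by (auto simp: ep_word_append dest: triangle_edges)
qed (auto simp: ep_word_append dest: edge_vertices)

text \<open>Each defining relation is already stated in an arbitrary context, so enlarging it is harmless.\<close>
lemma ep_equiv_context:
  assumes "ep_equiv S a b w w'" "ep_word S p u a" "ep_word S b v q"
  shows "ep_equiv S p q (u @ w @ v) (u @ w' @ v)"
  using assms
proof (induction rule: ep_equiv.induct)
  case (refl w)
  then have "ep_word S p (u @ w @ v) q" by (auto simp: ep_word_append)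
  then show ?case by (rule ep_equiv.refl)
next
  case (sym w w')
  then show ?case by (blast intro: ep_equiv.sym)
next
  case (trans w w' w'')
  then show ?case by (blast intro: ep_equiv.trans)
next
  case (right_inverse u' x y v')
  then have "ep_word S p ((u @ u') @ [Fwd x y, Bwd x y] @ (v' @ v)) q"
    by (auto simp: ep_word_append)
  from ep_equiv.right_inverse[OF this] show ?case by simp
next
  case (left_inverse u' x y v')
  then have "ep_word S p ((u @ u') @ [Bwd x y, Fwd x y] @ (v' @ v)) q"
    by (auto simp: ep_word_append)
  from ep_equiv.left_inverse[OF this] show ?case by simp
next
  case (degenerate u' x v')
  then have "ep_word S p ((u @ u') @ [Fwd x x] @ (v' @ v)) q"
    by (auto simp: ep_word_append)
  from ep_equiv.degenerate[OF this] show ?case by simp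
next
  case (triangle x y z u' v')
  then have "ep_word S p ((u @ u') @ [Fwd x z] @ (v' @ v)) q"
    by (auto simp: ep_word_append)
  from ep_equiv.triangle[OF triangle(1) this] show ?case by simp
qed

lemma ep_equiv_append:
  assumes "ep_equiv S a b u u'" "ep_equiv S b c v v'"
  shows "ep_equiv S a c (u @ v) (u' @ v')"
proof -
  have "ep_equiv S a c ([] @ u @ v) ([] @ u' @ v)"
    by (rule ep_equiv_context[OF assms(1)])
      (use assms ep_equiv_words ep_word_vertices in fastforce)+
  moreover have "ep_equiv S a c (u' @ v @ []) (u' @ v' @ [])"
    by (rule ep_equiv_context[OF assms(2)])
      (use assms ep_equiv_words ep_word_vertices in fastforce)+
  ultimately show ?thesis
    by (auto intro: ep_equiv.trans)
qed

end

definition ep_class ::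
    "(nat \<Rightarrow> 'a list set) \<Rightarrow> 'a \<Rightarrow> 'a edge list \<Rightarrow> 'a \<Rightarrow> 'a \<times> 'a edge list set \<times> 'a" where
  "ep_class S a w b = (a, {w'. ep_equiv S a b w w'}, b)"

definition ep_generator ::
    "(nat \<Rightarrow> 'a list set) \<Rightarrow> 'a \<Rightarrow> 'a \<Rightarrow> 'a \<times> 'a edge list set \<times> 'a" where
  "ep_generator S x y = ep_class S x [Fwd x y] y"

primrec edge_flip :: "'a edge \<Rightarrow> 'a edge" where
  "edge_flip (Fwd x y) = Bwd x y"
| "edge_flip (Bwd x y) = Fwd x y"

abbreviation word_flip :: "'a edge list \<Rightarrow> 'a edge list" where
  "word_flip w \<equiv> rev (map edge_flip w)"

lemma edge_flip_flip [simp]: "edge_flip (edge_flip e) = e"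
  by (cases e) auto

lemma word_flip_flip: "word_flip (word_flip w) = w"
  by (simp add: rev_map comp_def)

context tuple_complex
begin

abbreviation EP :: "('a, 'a \<times> 'a edge list set \<times> 'a) gpd" where
  "EP \<equiv> edge_path_groupoid S"

lemma Ob_EP [simp]: "x \<in> Ob EP \<longleftrightarrow> [x] \<in> S 0"
  by (simp add: edge_path_groupoid_def)

lemma Ar_EP: "f \<in> Ar EP \<longleftrightarrow> (\<exists>a w b. f = ep_class S a w b \<and> ep_word S a w b)"
  by (auto simp: edge_path_groupoid_def ep_class_def)

lemma ep_class_in_Ar: "ep_word S a w b \<Longrightarrow> ep_class S a w b \<in> Ar EP"
  by (auto simp: Ar_EP)

lemma Ar_EP_E:
  assumes "f \<in> Ar EP"
  obtains a w b where "f = ep_class S a w b" "ep_word S a w b"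
  using assms by (auto simp: Ar_EP)

lemma Dom_EP [simp]: "Dom EP (ep_class S a w b) = a"
  and Cod_EP [simp]: "Cod EP (ep_class S a w b) = b"
  and Id_EP: "gpd.Id EP a = ep_class S a [] a"
  by (simp_all add: edge_path_groupoid_def ep_class_def)

lemma ep_class_eqI: "ep_equiv S a b w w' \<Longrightarrow> ep_class S a w b = ep_class S a w' b"
  unfolding ep_class_def by (auto intro: ep_equiv.sym ep_equiv.trans)

lemma Comp_EP:
  assumes "ep_word S a u b" "ep_word S b v c"
  shows "Comp EP (ep_class S a u b) (ep_class S b v c) = ep_class S a (u @ v) c"
proof -
  have "(\<exists>u'. ep_equiv S a b u u' \<and> (\<exists>v'. ep_equiv S b c v v' \<and> ep_equiv S a c (u' @ v') w))
        \<longleftrightarrow> ep_equiv S a c (u @ v) w" for w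
    using assms by (meson ep_equiv.refl ep_equiv.trans ep_equiv_append)
  then show ?thesis
    by (simp add: edge_path_groupoid_def ep_class_def)
qed

lemma ep_word_flip: "ep_word S a w b \<Longrightarrow> ep_word S b (word_flip w) a"
proof (induction w arbitrary: a)
  case (Cons e w)
  then show ?case by (cases e) (auto simp: ep_word_append dest: edge_vertices)
qed auto

text \<open>Letters cancel from the middle of the word outwards.\<close>
lemma ep_equiv_flip: "ep_word S a w b \<Longrightarrow> ep_equiv S a a (w @ word_flip w) []"
proof (induction w arbitrary: a)
  case Nil
  then show ?case by (auto intro: ep_equiv.refl)
next
  case (Cons e w)
  obtain c where c: "ep_word S a [e] c" "ep_word S c w b"
    using Cons.prems ep_word_append[of a "[e]" w b] by auto
  have flip: "ep_word S c [edge_flip e] a"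
    using ep_word_flip[OF c(1)] by simp
  have "ep_equiv S a a ([e] @ (w @ word_flip w) @ [edge_flip e]) ([e] @ [] @ [edge_flip e])"
    by (rule ep_equiv_context[OF Cons.IH[OF c(2)] c(1) flip])
  moreover have "ep_equiv S a a ([] @ [e, edge_flip e] @ []) ([] @ [])"
  proof (cases e)
    case (Fwd x y)
    then show ?thesis
      using c flip ep_equiv.right_inverse[of S a "[]" x y "[]" a] by (auto dest: edge_vertices)
  next
    case (Bwd x y)
    then show ?thesis
      using c flip ep_equiv.left_inverse[of S a "[]" x y "[]" a] by (auto dest: edge_vertices)
  qed
  ultimately show ?case
    by (auto intro: ep_equiv.trans)
qed

lemma groupoid_EP: "groupoid EP"
proof
  fix x assume "x \<in> Ob EP"
  then show "gpd.Id EP x \<in> Ar EP"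
    by (simp add: Id_EP ep_class_in_Ar)
next
  fix f assume "f \<in> Ar EP"
  then obtain a w b where f: "f = ep_class S a w b" and w: "ep_word S a w b"
    by (rule Ar_EP_E)
  note w' = ep_word_flip[OF w] and ab = ep_word_vertices[OF w]
  show "Dom EP f \<in> Ob EP" "Cod EP f \<in> Ob EP"
    using ab by (simp_all add: f)
  show "Comp EP (gpd.Id EP (Dom EP f)) f = f" "Comp EP f (gpd.Id EP (Cod EP f)) = f"
    using w ab Comp_EP[of a "[]" a w b] Comp_EP[of a w b "[]" b] by (simp_all add: f Id_EP)
  have "ep_class S a (w @ word_flip w) a = gpd.Id EP a"
    "ep_class S b (word_flip w @ w) b = gpd.Id EP b"
    using ep_equiv_flip[OF w] ep_equiv_flip[OF w']
    by (auto simp: Id_EP word_flip_flip intro!: ep_class_eqI)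
  then show "\<exists>g\<in>Ar EP. Dom EP g = Cod EP f \<and> Cod EP g = Dom EP f \<and>
      Comp EP f g = gpd.Id EP (Dom EP f) \<and> Comp EP g f = gpd.Id EP (Cod EP f)"
    using w w'
    by (intro bexI[of _ "ep_class S b (word_flip w) a"] ep_class_in_Ar)
      (simp_all add: f Comp_EP)
next
  fix f g assume "f \<in> Ar EP" and "g \<in> Ar EP" and fg: "Cod EP f = Dom EP g"
  then obtain a u b b' v c where f: "f = ep_class S a u b" "ep_word S a u b"
    and g: "g = ep_class S b' v c" "ep_word S b' v c"
    by (meson Ar_EP_E)
  have [simp]: "b' = b" using fg by (simp add: f g)
  have uv: "ep_word S a (u @ v) c"
    using f g by (auto simp: ep_word_append)
  show "Comp EP f g \<in> Ar EP" "Dom EP (Comp EP f g) = Dom EP f" "Cod EP (Comp EP f g) = Cod EP g"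
    using f g uv by (simp_all add: Comp_EP ep_class_in_Ar)
  fix h assume "h \<in> Ar EP" and gh: "Cod EP g = Dom EP h"
  then obtain c' w d where h: "h = ep_class S c' w d" "ep_word S c' w d"
    by (meson Ar_EP_E)
  have [simp]: "c' = c" using gh by (simp add: g h)
  have vw: "ep_word S b (v @ w) d"
    using g h by (auto simp: ep_word_append)
  show "Comp EP (Comp EP f g) h = Comp EP f (Comp EP g h)"
    using f g h uv vw by (simp add: Comp_EP)
qed (simp_all add: Id_EP)

lemma generator_in_Ar: "[x, y] \<in> S (Suc 0) \<Longrightarrow> ep_generator S x y \<in> Ar EP"
  unfolding Ar_EP ep_generator_def using ep_word_Fwd by blast

lemma Dom_generator [simp]: "Dom EP (ep_generator S x y) = x"
  and Cod_generator [simp]: "Cod EP (ep_generator S x y) = y"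
  by (simp_all add: ep_generator_def)

lemma generator_loop: "[x] \<in> S 0 \<Longrightarrow> ep_generator S x x = gpd.Id EP x"
  unfolding ep_generator_def Id_EP
  using ep_equiv.degenerate[of S x "[]" x "[]" x] by (auto intro!: ep_class_eqI dest: loop_edge)

lemma generator_triangle:
  assumes "[x, y, z] \<in> S 2"
  shows "Comp EP (ep_generator S x y) (ep_generator S y z) = ep_generator S x z"
proof -
  have e: "[x, y] \<in> S (Suc 0)" "[y, z] \<in> S (Suc 0)" "[x, z] \<in> S (Suc 0)"
    using triangle_edges[OF assms] by auto
  have "ep_equiv S x z ([] @ [Fwd x z] @ []) ([] @ [Fwd x y, Fwd y z] @ [])"
    by (rule ep_equiv.triangle, rule assms) (use e in \<open>auto dest: edge_vertices\<close>)
  then show ?thesis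
    using e unfolding ep_generator_def
    by (subst Comp_EP) (auto dest: edge_vertices ep_equiv.sym intro!: ep_class_eqI)
qed

text \<open>
  The values of a functor on generators satisfy the presentation; this is the form in which
  functors are used below.
\<close>
lemma functor_generator:
  assumes "groupoid_functor EP H F"
  shows "[x, y] \<in> S (Suc 0) \<Longrightarrow> on_Ar F (ep_generator S x y) \<in> Ar H"
    "[x, y] \<in> S (Suc 0) \<Longrightarrow> Dom H (on_Ar F (ep_generator S x y)) = on_Ob F x"
    "[x, y] \<in> S (Suc 0) \<Longrightarrow> Cod H (on_Ar F (ep_generator S x y)) = on_Ob F y"
    "[x] \<in> S 0 \<Longrightarrow> on_Ar F (ep_generator S x x) = gpd.Id H (on_Ob F x)"
    "[x, y, z] \<in> S 2 \<Longrightarrow> Comp H (on_Ar F (ep_generator S x y)) (on_Ar F (ep_generator S y z)) =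
       on_Ar F (ep_generator S x z)"
proof -
  interpret F: groupoid_functor EP H F by fact
  show "[x, y] \<in> S (Suc 0) \<Longrightarrow> on_Ar F (ep_generator S x y) \<in> Ar H"
    "[x, y] \<in> S (Suc 0) \<Longrightarrow> Dom H (on_Ar F (ep_generator S x y)) = on_Ob F x"
    "[x, y] \<in> S (Suc 0) \<Longrightarrow> Cod H (on_Ar F (ep_generator S x y)) = on_Ob F y"
    by (simp_all add: F.on_Ar_in F.on_Ar_Dom F.on_Ar_Cod generator_in_Ar)
  show "[x] \<in> S 0 \<Longrightarrow> on_Ar F (ep_generator S x x) = gpd.Id H (on_Ob F x)"
    by (simp add: generator_loop F.on_Ar_Id)
  show "[x, y, z] \<in> S 2 \<Longrightarrow> Comp H (on_Ar F (ep_generator S x y)) (on_Ar F (ep_generator S y z)) =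
       on_Ar F (ep_generator S x z)"
    using triangle_edges[of x y z]
    by (simp add: generator_triangle[symmetric] F.on_Ar_Comp generator_in_Ar)
qed

text \<open>
  The generators generate: every word is a composite of generators and formal inverses. A formal
  inverse is a genuine inverse in the groupoid, and inverses are preserved and unique, so
  agreement on the \<open>Fwd\<close> letters already forces agreement on the \<open>Bwd\<close> letters.
\<close>
lemma functor_eqI:
  assumes F: "groupoid_functor EP H F" and F': "groupoid_functor EP H F'"
    and ob: "\<And>x. [x] \<in> S 0 \<Longrightarrow> on_Ob F x = on_Ob F' x"
    and gen: "\<And>x y. [x, y] \<in> S (Suc 0) \<Longrightarrow>
      on_Ar F (ep_generator S x y) = on_Ar F' (ep_generator S x y)"
  shows "gpd_map_eq EP F F'"
proof -
  interpret F: groupoid_functor EP H F by fact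
  interpret F': groupoid_functor EP H F' by fact
  have bwd: "on_Ar F (ep_class S y [Bwd x y] x) = on_Ar F' (ep_class S y [Bwd x y] x)"
    if e: "[x, y] \<in> S (Suc 0)" for x y
  proof -
    let ?g = "ep_generator S x y" and ?h = "ep_class S y [Bwd x y] x"
    have h: "?h \<in> Ar EP"
      using e edge_vertices[OF e] unfolding Ar_EP
      by (intro exI[of _ y] exI[of _ "[Bwd x y]"] exI[of _ x]) auto
    have "Comp EP ?g ?h = ep_class S x [Fwd x y, Bwd x y] x"
      unfolding ep_generator_def using e edge_vertices[OF e] by (subst Comp_EP) auto
    also have "\<dots> = gpd.Id EP x"
      unfolding Id_EP using ep_equiv.right_inverse[of S x "[]" x y "[]" x] e edge_vertices[OF e]
      by (auto intro!: ep_class_eqI)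
    finally have gh: "Comp EP ?g ?h = gpd.Id EP x" .
    have "Comp H (on_Ar F ?g) (on_Ar F ?h) = gpd.Id H (on_Ob F x)"
      using F.on_Ar_Comp[OF generator_in_Ar[OF e] h] gh edge_vertices[OF e]
      by (simp add: F.on_Ar_Id)
    moreover have "Comp H (on_Ar F ?g) (on_Ar F' ?h) = gpd.Id H (on_Ob F x)"
      using F'.on_Ar_Comp[OF generator_in_Ar[OF e] h] gh edge_vertices[OF e]
      by (simp add: F'.on_Ar_Id gen[OF e] ob)
    ultimately have eq: "Comp H (on_Ar F ?g) (on_Ar F ?h) = Comp H (on_Ar F ?g) (on_Ar F' ?h)"
      by simp
    show ?thesis
      by (rule F.H.left_cancel[OF _ _ _ _ _ eq])
        (use h generator_in_Ar[OF e] edge_vertices[OF e] in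
          \<open>simp_all add: F.on_Ar_in F'.on_Ar_in F.on_Ar_Dom F'.on_Ar_Dom F.on_Ar_Cod ob\<close>)
  qed
  have "on_Ar F (ep_class S a w b) = on_Ar F' (ep_class S a w b)" if "ep_word S a w b" for a w b
    using that
  proof (induction w arbitrary: a)
    case Nil
    then show ?case
      using F.on_Ar_Id[of b] F'.on_Ar_Id[of b] ob[of b] by (auto simp: Id_EP)
  next
    case (Cons e w)
    obtain c where c: "ep_word S a [e] c" "ep_word S c w b"
      using Cons.prems ep_word_append[of a "[e]" w b] by auto
    have e: "on_Ar F (ep_class S a [e] c) = on_Ar F' (ep_class S a [e] c)"
      using c(1) gen bwd by (cases e) (auto simp: ep_generator_def)
    have in_Ar: "ep_class S a [e] c \<in> Ar EP" "ep_class S c w b \<in> Ar EP"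
      using c unfolding Ar_EP by blast+
    have "ep_class S a (e # w) b = Comp EP (ep_class S a [e] c) (ep_class S c w b)"
      using c by (simp add: Comp_EP)
    then show ?case
      by (simp add: F.on_Ar_Comp F'.on_Ar_Comp in_Ar e Cons.IH[OF c(2)])
  qed
  then show ?thesis
    unfolding gpd_map_eq_def by (auto simp: Ar_EP ob)
qed

end

section \<open>Functors out of an edge-path groupoid\<close>

text \<open>
  The end point of the word is an argument because the empty word does not determine its object.
\<close>
primrec word_eval ::
    "('o, 'm) gpd \<Rightarrow> ('a \<Rightarrow> 'o) \<Rightarrow> ('a \<Rightarrow> 'a \<Rightarrow> 'm) \<Rightarrow> 'a edge list \<Rightarrow> 'a \<Rightarrow> 'm" where
  "word_eval H ob m [] b = gpd.Id H (ob b)"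
| "word_eval H ob m (e # w) b =
     Comp H (case e of Fwd x y \<Rightarrow> m x y | Bwd x y \<Rightarrow> gpd_inverse H (m x y)) (word_eval H ob m w b)"

definition functor_of_generators ::
    "('o, 'm) gpd \<Rightarrow> ('a \<Rightarrow> 'o) \<Rightarrow> ('a \<Rightarrow> 'a \<Rightarrow> 'm) \<Rightarrow> ('a, 'a \<times> 'a edge list set \<times> 'a, 'o, 'm) gpd_map" where
  "functor_of_generators H ob m =
     \<lparr> on_Ob = ob, on_Ar = (\<lambda>(x, C, y). word_eval H ob m (SOME w. w \<in> C) y) \<rparr>"

text \<open>The data that the presentation of an edge-path groupoid asks of a functor into \<open>H\<close>.\<close>
locale generator_assignment = tuple_complex S + H: groupoid H
  for S :: "nat \<Rightarrow> 'a list set" and H :: "('o, 'm) gpd" +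
  fixes ob :: "'a \<Rightarrow> 'o" and m :: "'a \<Rightarrow> 'a \<Rightarrow> 'm"
  assumes ob_in: "[x] \<in> S 0 \<Longrightarrow> ob x \<in> Ob H"
    and m_in: "[x, y] \<in> S (Suc 0) \<Longrightarrow> m x y \<in> Ar H \<and> Dom H (m x y) = ob x \<and> Cod H (m x y) = ob y"
    and m_loop: "[x] \<in> S 0 \<Longrightarrow> m x x = gpd.Id H (ob x)"
    and m_triangle: "[x, y, z] \<in> S 2 \<Longrightarrow> Comp H (m x y) (m y z) = m x z"
begin

lemma word_eval_in:
  "ep_word S a w b \<Longrightarrow> word_eval H ob m w b \<in> Ar H \<and>
     Dom H (word_eval H ob m w b) = ob a \<and> Cod H (word_eval H ob m w b) = ob b"
proof (induction w arbitrary: a)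
  case Nil
  then show ?case using ob_in[of b] by (auto simp: H.Id_in H.Dom_Id H.Cod_Id)
next
  case (Cons e w)
  then show ?case
    by (cases e) (auto simp: m_in H.gpd_inverse H.Comp_in H.Dom_Comp H.Cod_Comp)
qed

lemma word_eval_append:
  assumes "ep_word S a u c" "ep_word S c v b"
  shows "word_eval H ob m (u @ v) b = Comp H (word_eval H ob m u c) (word_eval H ob m v b)"
  using assms(1)
proof (induction u arbitrary: a)
  case Nil
  then show ?case
    using word_eval_in[OF assms(2)] H.Id_Comp[of "word_eval H ob m v b"] by simp
next
  case (Cons e u)
  then obtain a' where a': "ep_word S a [e] a'" "ep_word S a' u c"
    using ep_word_append[of a "[e]" u c] by auto
  let ?e = "case e of Fwd x y \<Rightarrow> m x y | Bwd x y \<Rightarrow> gpd_inverse H (m x y)"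
  have "?e \<in> Ar H" "Cod H ?e = ob a'"
    using a'(1) by (auto simp: m_in H.gpd_inverse split: edge.splits)
  then show ?case
    using Cons.IH[OF a'(2)] word_eval_in[OF a'(2)] word_eval_in[OF assms(2)]
    by (simp add: H.Comp_assoc)
qed

lemma word_eval_Fwd: "[x, y] \<in> S (Suc 0) \<Longrightarrow> word_eval H ob m [Fwd x y] y = m x y"
  using m_in[of x y] H.Comp_Id[of "m x y"] by simp

text \<open>
  All defining relations have the form \<open>u @ w @ v \<sim> u @ w' @ v\<close>, so it suffices to compare the
  values of the short words \<open>w\<close> and \<open>w'\<close>.
\<close>
lemma word_eval_replace:
  assumes word: "ep_word S a (u @ w @ v) b"
    and local: "\<And>p q. ep_word S p w q \<Longrightarrow>
      ep_word S p w' q \<and> word_eval H ob m w q = word_eval H ob m w' q"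
  shows "word_eval H ob m (u @ w @ v) b = word_eval H ob m (u @ w' @ v) b"
proof -
  obtain p q where pq: "ep_word S a u p" "ep_word S p w q" "ep_word S q v b"
    using word unfolding ep_word_append by blast
  note w' = local[OF pq(2)]
  have "ep_word S p (w @ v) b" "ep_word S p (w' @ v) b"
    using pq w' by (auto simp: ep_word_append)
  then show ?thesis
    using pq w' word_eval_append[of p w' q v b] by (simp add: word_eval_append)
qed

lemma word_eval_equiv: "ep_equiv S a b w w' \<Longrightarrow> word_eval H ob m w b = word_eval H ob m w' b"
proof (induction rule: ep_equiv.induct)
  case (right_inverse u x y v)
  have "ep_word S p [] q \<and> word_eval H ob m [Fwd x y, Bwd x y] q = word_eval H ob m [] q"
    if "ep_word S p [Fwd x y, Bwd x y] q" for p q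
    using that m_in[of x y] H.gpd_inverse[of "m x y"] H.Comp_Id[of "gpd_inverse H (m x y)"]
    by (auto dest: edge_vertices)
  from word_eval_replace[OF right_inverse this] show ?case by simp
next
  case (left_inverse u x y v)
  have "ep_word S p [] q \<and> word_eval H ob m [Bwd x y, Fwd x y] q = word_eval H ob m [] q"
    if "ep_word S p [Bwd x y, Fwd x y] q" for p q
    using that m_in[of x y] H.gpd_inverse[of "m x y"] H.Comp_Id[of "m x y"]
    by (auto dest: edge_vertices)
  from word_eval_replace[OF left_inverse this] show ?case by simp
next
  case (degenerate u x v)
  have "ep_word S p [] q \<and> word_eval H ob m [Fwd x x] q = word_eval H ob m [] q"
    if "ep_word S p [Fwd x x] q" for p q
    using that m_in[of x x] m_loop[of x] H.Comp_Id[of "m x x"]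
    by (auto dest: edge_vertices)
  from word_eval_replace[OF degenerate this] show ?case by simp
next
  case (triangle x y z u v)
  have e: "[x, y] \<in> S (Suc 0)" "[y, z] \<in> S (Suc 0)" "[x, z] \<in> S (Suc 0)"
    using triangle_edges[OF triangle(1)] by auto
  have "ep_word S p [Fwd x y, Fwd y z] q \<and>
      word_eval H ob m [Fwd x z] q = word_eval H ob m [Fwd x y, Fwd y z] q"
    if "ep_word S p [Fwd x z] q" for p q
    using that e m_in[OF e(2)] m_in[OF e(3)] m_triangle[OF triangle(1)]
      H.Comp_Id[of "m y z"] H.Comp_Id[of "m x z"] by auto
  from word_eval_replace[OF triangle(2) this] show ?case by simp
qed auto

lemma on_Ar_ep_class:
  assumes "ep_word S a w b"
  shows "on_Ar (functor_of_generators H ob m) (ep_class S a w b) = word_eval H ob m w b"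
proof -
  have "ep_equiv S a b w (SOME w'. ep_equiv S a b w w')"
    by (rule someI) (rule ep_equiv.refl[OF assms])
  then show ?thesis
    by (simp add: functor_of_generators_def ep_class_def word_eval_equiv)
qed

lemma on_Ar_generator:
  "[x, y] \<in> S (Suc 0) \<Longrightarrow> on_Ar (functor_of_generators H ob m) (ep_generator S x y) = m x y"
  unfolding ep_generator_def using on_Ar_ep_class ep_word_Fwd word_eval_Fwd by metis

text \<open>
  Evaluation is constant on classes and multiplicative on concatenations, which is the universal
  property of the edge-path groupoid.
\<close>
theorem groupoid_functor_of_generators: "groupoid_functor EP H (functor_of_generators H ob m)"
proof -
  interpret EP: groupoid EP by (rule groupoid_EP)
  let ?F = "functor_of_generators H ob m"
  have ob: "on_Ob ?F x = ob x" for x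
    by (simp add: functor_of_generators_def)
  show ?thesis
  proof
    fix x assume "x \<in> Ob EP"
    then show "on_Ob ?F x \<in> Ob H" "on_Ar ?F (gpd.Id EP x) = gpd.Id H (on_Ob ?F x)"
      by (simp_all add: ob ob_in Id_EP on_Ar_ep_class)
  next
    fix f assume "f \<in> Ar EP"
    then show "on_Ar ?F f \<in> Ar H" "Dom H (on_Ar ?F f) = on_Ob ?F (Dom EP f)"
      "Cod H (on_Ar ?F f) = on_Ob ?F (Cod EP f)"
      by (auto simp: Ar_EP on_Ar_ep_class word_eval_in ob)
  next
    fix f g assume "f \<in> Ar EP" and "g \<in> Ar EP" and fg: "Cod EP f = Dom EP g"
    then obtain a u b b' v c where f: "f = ep_class S a u b" "ep_word S a u b"
      and g: "g = ep_class S b' v c" "ep_word S b' v c"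
      by (meson Ar_EP_E)
    have [simp]: "b' = b" using fg by (simp add: f g)
    have "ep_word S a (u @ v) c"
      using f g by (auto simp: ep_word_append)
    then show "on_Ar ?F (Comp EP f g) = Comp H (on_Ar ?F f) (on_Ar ?F g)"
      using f g by (simp add: Comp_EP on_Ar_ep_class word_eval_append)
  qed
qed

end

section \<open>Induced functors\<close>

text \<open>
  The functor induced by a simplicial map of tuple complexes; for nerves of graphs it is
  \<open>\<Pi>\<^sub>1map\<close>, see \<open>fundamental_groupoid_map_eq\<close>.
\<close>
definition edge_path_map ::
    "(nat \<Rightarrow> 'b list set) \<Rightarrow> ('a \<Rightarrow> 'b) \<Rightarrow>
     ('a, 'a \<times> 'a edge list set \<times> 'a, 'b, 'b \<times> 'b edge list set \<times> 'b) gpd_map" where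
  "edge_path_map S' f =
     \<lparr> on_Ob = f,
       on_Ar = (\<lambda>(x, C, y).
         (f x, {w'. \<exists>w\<in>C. ep_equiv S' (f x) (f y) (map (map_edge f) w) w'}, f y)) \<rparr>"

locale tuple_complex_map = S: tuple_complex S + S': tuple_complex S'
  for S :: "nat \<Rightarrow> 'a list set" and S' :: "nat \<Rightarrow> 'b list set" +
  fixes f :: "'a \<Rightarrow> 'b"
  assumes map_simplex: "xs \<in> S n \<Longrightarrow> map f xs \<in> S' n"
begin

lemma ep_word_map: "ep_word S a w b \<Longrightarrow> ep_word S' (f a) (map (map_edge f) w) (f b)"
proof (induction w arbitrary: a)
  case Nil
  then show ?case using map_simplex[of "[a]" 0] by auto
next
  case (Cons e w)
  then show ?case
    by (cases e) (auto dest: map_simplex)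
qed

lemma ep_equiv_map:
  "ep_equiv S a b w w' \<Longrightarrow> ep_equiv S' (f a) (f b) (map (map_edge f) w) (map (map_edge f) w')"
proof (induction rule: ep_equiv.induct)
  case (refl w)
  then show ?case by (auto intro: ep_equiv.refl ep_word_map)
next
  case (sym w w')
  then show ?case by (blast intro: ep_equiv.sym)
next
  case (trans w w' w'')
  then show ?case by (blast intro: ep_equiv.trans)
next
  case (right_inverse u x y v)
  from ep_word_map[OF this]
  show ?case using ep_equiv.right_inverse[of S' "f a" "map (map_edge f) u" "f x" "f y"] by simp
next
  case (left_inverse u x y v)
  from ep_word_map[OF this]
  show ?case using ep_equiv.left_inverse[of S' "f a" "map (map_edge f) u" "f x" "f y"] by simp
next
  case (degenerate u x v)
  from ep_word_map[OF this]
  show ?case using ep_equiv.degenerate[of S' "f a" "map (map_edge f) u" "f x"] by simp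
next
  case (triangle x y z u v)
  from ep_word_map[OF triangle(2)] map_simplex[OF triangle(1)]
  show ?case using ep_equiv.triangle[of "f x" "f y" "f z" S' "f a" "map (map_edge f) u"] by simp
qed

lemma on_Ar_map_ep_class:
  assumes "ep_word S a w b"
  shows "on_Ar (edge_path_map S' f) (ep_class S a w b) =
    ep_class S' (f a) (map (map_edge f) w) (f b)"
proof -
  have "(\<exists>u. ep_equiv S a b w u \<and> ep_equiv S' (f a) (f b) (map (map_edge f) u) w') \<longleftrightarrow>
      ep_equiv S' (f a) (f b) (map (map_edge f) w) w'" for w'
    using assms by (meson ep_equiv.refl ep_equiv.trans ep_equiv_map)
  then show ?thesis
    by (simp add: edge_path_map_def ep_class_def)
qed

lemma on_Ar_map_generator:
  "[x, y] \<in> S (Suc 0) \<Longrightarrow>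
     on_Ar (edge_path_map S' f) (ep_generator S x y) = ep_generator S' (f x) (f y)"
  unfolding ep_generator_def using S.ep_word_Fwd[of x y] by (subst on_Ar_map_ep_class) auto

lemma on_Ob_map [simp]: "on_Ob (edge_path_map S' f) x = f x"
  by (simp add: edge_path_map_def)

lemma groupoid_functor_map: "groupoid_functor S.EP S'.EP (edge_path_map S' f)"
proof -
  interpret S: groupoid S.EP by (rule S.groupoid_EP)
  interpret S': groupoid S'.EP by (rule S'.groupoid_EP)
  let ?F = "edge_path_map S' f"
  show ?thesis
  proof
    fix x assume x: "x \<in> Ob S.EP"
    then show "on_Ob ?F x \<in> Ob S'.EP"
      using map_simplex[of "[x]" 0] by simp
    show "on_Ar ?F (gpd.Id S.EP x) = gpd.Id S'.EP (on_Ob ?F x)"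
      using x by (simp add: S.Id_EP S'.Id_EP on_Ar_map_ep_class)
  next
    fix h assume "h \<in> Ar S.EP"
    then obtain a w b where "h = ep_class S a w b" "ep_word S a w b"
      by (rule S.Ar_EP_E)
    then show "on_Ar ?F h \<in> Ar S'.EP" "Dom S'.EP (on_Ar ?F h) = on_Ob ?F (Dom S.EP h)"
      "Cod S'.EP (on_Ar ?F h) = on_Ob ?F (Cod S.EP h)"
      by (simp_all add: on_Ar_map_ep_class S'.ep_class_in_Ar ep_word_map)
  next
    fix h k assume "h \<in> Ar S.EP" and "k \<in> Ar S.EP" and hk: "Cod S.EP h = Dom S.EP k"
    then obtain a u b b' v c where h: "h = ep_class S a u b" "ep_word S a u b"
      and k: "k = ep_class S b' v c" "ep_word S b' v c"
      by (meson S.Ar_EP_E)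
    have [simp]: "b' = b" using hk by (simp add: h k)
    have "ep_word S a (u @ v) c"
      using h k by (auto simp: S.ep_word_append)
    then show "on_Ar ?F (Comp S.EP h k) = Comp S'.EP (on_Ar ?F h) (on_Ar ?F k)"
      using h k by (simp add: S.Comp_EP S'.Comp_EP on_Ar_map_ep_class ep_word_map)
  qed
qed

end

section \<open>Distances and simplices of low dimension\<close>

lemma ddist_le: "(x, y) \<in> parcs X ^^ n \<Longrightarrow> ddist X x y \<le> enat n"
  unfolding ddist_def by (rule INF_lower) simp

lemma Inf_enat_in: "N \<noteq> {} \<Longrightarrow> Inf N \<in> N" for N :: "enat set"
  unfolding Inf_enat_def by (auto intro: LeastI)

lemma ddist_attained:
  assumes "ddist X x y < \<infinity>"
  obtains n where "(x, y) \<in> parcs X ^^ n" "ddist X x y = enat n"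
proof -
  let ?N = "enat ` {n. (x, y) \<in> parcs X ^^ n}"
  have "?N \<noteq> {}"
  proof
    assume "?N = {}"
    then have "ddist X x y = \<infinity>"
      unfolding ddist_def by (simp only: Inf_enat_def simp_thms if_True)
    then show False using assms by simp
  qed
  then have "Inf ?N \<in> ?N"
    by (rule Inf_enat_in)
  then show ?thesis
    using that unfolding ddist_def by blast
qed

lemma ddist_refl [simp]: "ddist X x x = 0"
  using ddist_le[of x x 0 X] by (simp add: zero_enat_def[symmetric])

lemma ddist_triangle: "ddist X x z \<le> ddist X x y + ddist X y z"
proof (cases "ddist X x y + ddist X y z < \<infinity>")
  case True
  then have "ddist X x y < \<infinity>" "ddist X y z < \<infinity>"
    by (auto simp: plus_eq_infty_iff_enat)
  then obtain m n where "(x, y) \<in> parcs X ^^ m" "ddist X x y = enat m"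
    "(y, z) \<in> parcs X ^^ n" "ddist X y z = enat n"
    by (meson ddist_attained)
  then show ?thesis
    using ddist_le[of x z "m + n" X] by (auto simp: relpow_add)
qed auto

lemma ddist_leI:
  assumes "\<And>n. (x, y) \<in> parcs X ^^ n \<Longrightarrow> d \<le> enat n"
  shows "d \<le> ddist X x y"
  unfolding ddist_def by (rule INF_greatest) (use assms in auto)

lemma ddist_digraph_map:
  assumes "digraph_map X Y f"
  shows "ddist Y (f x) (f y) \<le> ddist X x y"
proof (rule ddist_leI)
  fix n assume "(x, y) \<in> parcs X ^^ n"
  then show "ddist Y (f x) (f y) \<le> enat n"
  proof (induction n arbitrary: y)
    case 0
    then show ?case by simp
  next
    case (Suc n)
    then obtain z where z: "(x, z) \<in> parcs X ^^ n" "(z, y) \<in> parcs X"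
      by (meson relpow_Suc_E)
    have "ddist Y (f z) (f y) \<le> enat 1"
      using assms z(2) ddist_le[of "f z" "f y" 1 Y] unfolding digraph_map_def by fastforce
    then have "ddist Y (f x) (f z) + ddist Y (f z) (f y) \<le> enat n + enat 1"
      using Suc.IH[OF z(1)] by (rule add_mono[rotated])
    then show ?case
      using ddist_triangle[of Y "f x" "f y" "f z"] by simp
  qed
qed

text \<open>
  The condition on the length of a simplex, uniformly for finite and infinite \<open>s\<close>. It is
  inherited by smaller lengths and implies finiteness; the arguments below rest on these two
  properties.
\<close>
definition admissible :: "enat \<Rightarrow> enat \<Rightarrow> bool" where
  "admissible s d \<longleftrightarrow> (if s = \<infinity> then d < \<infinity> else d \<le> s)"

lemma admissible_mono: "admissible s d \<Longrightarrow> d' \<le> d \<Longrightarrow> admissible s d'"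
  unfolding admissible_def by (metis order_le_less_trans order_trans)

lemma admissible_finite: "admissible s d \<Longrightarrow> d < \<infinity>"
  by (cases s; cases d) (auto simp: admissible_def)

lemma admissible_0 [simp]: "admissible s 0"
  by (simp add: admissible_def)

lemma admissible_addD: "admissible s (d + e) \<Longrightarrow> admissible s d \<and> admissible s e"
  by (auto intro: admissible_mono)

lemma nerve_iff:
  "xs \<in> nerve s X n \<longleftrightarrow>
     length xs = Suc n \<and> set xs \<subseteq> pverts X \<and> admissible s (tuple_length X xs)"
  by (auto simp: nerve_def admissible_def)

lemma nerve_vertex [simp]: "[x] \<in> nerve s X 0 \<longleftrightarrow> x \<in> pverts X"
  by (auto simp: nerve_iff tuple_length_def)

lemma nerve_edge [simp]:
  "[x, y] \<in> nerve s X (Suc 0) \<longleftrightarrow> x \<in> pverts X \<and> y \<in> pverts X \<and> admissible s (ddist X x y)"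
  by (auto simp: nerve_iff tuple_length_def)

lemma nerve_triangle [simp]:
  "[x, y, z] \<in> nerve s X 2 \<longleftrightarrow> x \<in> pverts X \<and> y \<in> pverts X \<and> z \<in> pverts X \<and>
     admissible s (ddist X x y + ddist X y z)"
  by (auto simp: nerve_iff tuple_length_def numeral_2_eq_2)

lemma tuple_complex_nerve: "tuple_complex (nerve s X)"
  by unfold_locales (auto dest: admissible_addD intro: admissible_mono[OF _ ddist_triangle])

lemma map_nerve:
  assumes f: "digraph_map X Y f" and xs: "xs \<in> nerve s X n"
  shows "map f xs \<in> nerve s Y n"
proof -
  have "tuple_length Y (map f xs) \<le> tuple_length X xs"
    unfolding tuple_length_def using ddist_digraph_map[OF f] by (auto intro!: sum_mono)
  moreover have "set (map f xs) \<subseteq> pverts Y"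
    using f xs by (auto simp: digraph_map_def nerve_def)
  ultimately show ?thesis
    using xs by (auto simp: nerve_iff intro: admissible_mono)
qed

lemma tuple_complex_map_nerve:
  "digraph_map X Y f \<Longrightarrow> tuple_complex_map (nerve s X) (nerve s Y) f"
  by (intro tuple_complex_map.intro tuple_complex_nerve tuple_complex_map_axioms.intro map_nerve)

lemma fundamental_groupoid_map_eq: "\<Pi>\<^sub>1map s Y f = edge_path_map (nerve s Y) f"
  by (simp add: fundamental_groupoid_map_def edge_path_map_def)

section \<open>Distances in a pushout along a closed subgraph\<close>

text \<open>
  The distances in the pushout only depend on \<open>A\<close> being an induced subgraph of \<open>X\<close> that no arc
  enters from outside; the retraction of a cofibration comes in later.
\<close>
locale closed_subgraph_pushout =
  fixes A X :: "'x pair_pre_digraph" and Y :: "'y pair_pre_digraph"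
    and f :: "'x \<Rightarrow> 'x" and g :: "'x \<Rightarrow> 'y"
  assumes A: "pair_loopfree_digraph A" and X: "pair_loopfree_digraph X"
    and Y: "pair_loopfree_digraph Y"
    and map_f: "digraph_map A X f" and map_g: "digraph_map A Y g"
    and f_id: "a \<in> pverts A \<Longrightarrow> f a = a"
    and A_subset: "pverts A \<subseteq> pverts X"
    and A_induced: "u \<in> pverts A \<Longrightarrow> v \<in> pverts A \<Longrightarrow> (u, v) \<in> parcs A \<longleftrightarrow> (u, v) \<in> parcs X"
    and A_closed: "(u, v) \<in> parcs X \<Longrightarrow> v \<in> pverts A \<Longrightarrow> u \<in> pverts A"
begin

abbreviation P where "P \<equiv> pushout_graph A X Y f g"
abbreviation i where "i \<equiv> pushout_inl A f g"
abbreviation j where "j \<equiv> pushout_inr A f g"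

lemma map_i: "digraph_map X P i" and map_j: "digraph_map Y P j"
  and i_eq_j: "a \<in> pverts A \<Longrightarrow> i a = j (g a)"
  using pushout_graph_is_pushout(2-4)[OF A X Y map_f map_g] f_id by auto

text \<open>
  A choice of representatives for the gluing relation: vertices of \<open>A\<close> are moved to \<open>Y\<close>. As \<open>A\<close>
  is embedded in \<open>X\<close>, this decides the relation and shows that \<open>Y\<close> and \<open>X - A\<close> embed disjointly.
\<close>
definition normal_form :: "'x + 'y \<Rightarrow> 'x + 'y" where
  "normal_form p = (case p of Inl x \<Rightarrow> if x \<in> pverts A then Inr (g x) else Inl x | Inr y \<Rightarrow> Inr y)"

lemma glue_iff: "glue A f g p q \<longleftrightarrow> normal_form p = normal_form q"
proof
  assume "glue A f g p q"
  then show "normal_form p = normal_form q"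
    unfolding glue_def
    by (induction rule: equivclp_induct) (auto simp: normal_form_def f_id)
next
  have nf: "glue A f g p (normal_form p)" for p
    unfolding glue_def normal_form_def
    by (auto split: sum.splits intro: r_into_equivclp simp: f_id)
  assume eq: "normal_form p = normal_form q"
  show "glue A f g p q"
    using equivclp_trans[OF nf[of p, unfolded glue_def eq] equivclp_sym[OF nf[of q, unfolded glue_def]]]
    by (simp only: glue_def)
qed

lemma j_inj: "j y = j y' \<longleftrightarrow> y = y'"
  by (simp add: pushout_inr_eq_iff glue_iff normal_form_def)

lemma i_eq_i: "x \<notin> pverts A \<Longrightarrow> i x = i x' \<longleftrightarrow> x = x'"
  by (auto simp: pushout_inl_eq_iff glue_iff normal_form_def)

lemma i_eq_j_iff: "i x = j y \<longleftrightarrow> x \<in> pverts A \<and> g x = y"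
  by (auto simp: pushout_inl_inr_eq_iff glue_iff normal_form_def)

lemma pverts_P: "p \<in> pverts P \<longleftrightarrow> (\<exists>y\<in>pverts Y. p = j y) \<or> (\<exists>x\<in>pverts X - pverts A. p = i x)"
proof -
  have "i x \<in> j ` pverts Y" if "x \<in> pverts A" for x
    using that map_g i_eq_j unfolding digraph_map_def by blast
  then have "pverts P = j ` pverts Y \<union> i ` (pverts X - pverts A)"
    using A_subset by (auto simp: pushout_graph_def)
  then show ?thesis by blast
qed

lemma vertex_P_cases:
  assumes "p \<in> pverts P"
  obtains y where "y \<in> pverts Y" "p = j y" | x where "x \<in> pverts X - pverts A" "p = i x"
  using assms unfolding pverts_P by blast

text \<open>
  An arc of \<open>X\<close> with both ends in \<open>A\<close> is already the image of an arc of \<open>Y\<close>, unless it has been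
  contracted, in which case it does not occur in the pushout.
\<close>
lemma arc_from_j:
  assumes "(j y, q) \<in> parcs P"
  shows "(\<exists>y'. q = j y' \<and> (y, y') \<in> parcs Y) \<or>
    (\<exists>a\<in>pverts A. \<exists>x\<in>pverts X - pverts A. g a = y \<and> (a, x) \<in> parcs X \<and> q = i x)"
proof -
  interpret X: pair_loopfree_digraph X by (rule X)
  have ne: "q \<noteq> j y"
    using assms by (auto simp: pushout_graph_def)
  from assms consider y1 y2 where "j y = j y1" "q = j y2" "(y1, y2) \<in> parcs Y"
    | u v where "j y = i u" "q = i v" "(u, v) \<in> parcs X"
    by (auto simp: pushout_graph_def)
  then show ?thesis
  proof cases
    case 1
    then show ?thesis by (auto simp: j_inj)
  next
    case (2 u v)
    have u: "u \<in> pverts A" "g u = y"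
      using i_eq_j_iff[of u y] 2(1) by auto
    show ?thesis
    proof (cases "v \<in> pverts A")
      case True
      then have "(u, v) \<in> parcs A" and "q = j (g v)"
        using u 2 by (auto simp: A_induced i_eq_j)
      then show ?thesis
        using map_g u ne unfolding digraph_map_def by metis
    next
      case False
      then show ?thesis
        using u 2 X.wellformed' by blast
    qed
  qed
qed

text \<open>Since no arc enters \<open>A\<close> from outside, the part \<open>X - A\<close> cannot be left.\<close>
lemma arc_from_i:
  assumes "(i x, q) \<in> parcs P" "x \<in> pverts X - pverts A"
  shows "\<exists>x'\<in>pverts X - pverts A. q = i x' \<and> (x, x') \<in> parcs X"
proof -
  interpret X: pair_loopfree_digraph X by (rule X)
  from assms(1) consider y1 where "i x = j y1"
    | u v where "i x = i u" "q = i v" "(u, v) \<in> parcs X"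
    by (auto simp: pushout_graph_def)
  then show ?thesis
  proof cases
    case 1
    then show ?thesis using assms(2) by (auto simp: i_eq_j_iff)
  next
    case (2 u v)
    then have "u = x"
      using assms(2) i_eq_i[of x u] by auto
    then show ?thesis
      using 2 assms(2) A_closed[of u v] X.wellformed' by blast
  qed
qed

lemma path_from_i:
  assumes "(i x, q) \<in> parcs P ^^ n" "x \<in> pverts X - pverts A"
  shows "\<exists>x'\<in>pverts X - pverts A. q = i x' \<and> (x, x') \<in> parcs X ^^ n"
  using assms(1)
proof (induction n arbitrary: q)
  case 0
  then show ?case using assms(2) by auto
next
  case (Suc n)
  then obtain p where "(i x, p) \<in> parcs P ^^ n" "(p, q) \<in> parcs P"
    by (meson relpow_Suc_E)
  then show ?case
    using Suc.IH arc_from_i by (metis relpow_Suc_I)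
qed

text \<open>
  A path starting in \<open>Y\<close> either stays there or crosses exactly once, at a vertex of \<open>A\<close>, because
  \<open>X - A\<close> cannot be left again. All statements on distances from \<open>Y\<close> come from this.
\<close>
lemma path_from_j:
  assumes "(j y, q) \<in> parcs P ^^ n"
  shows "(\<exists>y'. q = j y' \<and> (y, y') \<in> parcs Y ^^ n) \<or>
    (\<exists>a\<in>pverts A. \<exists>x\<in>pverts X - pverts A. \<exists>k l. n = k + l \<and>
       (y, g a) \<in> parcs Y ^^ k \<and> (a, x) \<in> parcs X ^^ l \<and> q = i x)"
  using assms
proof (induction n arbitrary: q)
  case 0
  then show ?case by auto
next
  case (Suc n)
  then obtain p where p: "(j y, p) \<in> parcs P ^^ n" and pq: "(p, q) \<in> parcs P"
    by (meson relpow_Suc_E)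
  from Suc.IH[OF p] consider y' where "p = j y'" "(y, y') \<in> parcs Y ^^ n"
    | a x k l where "a \<in> pverts A" "x \<in> pverts X - pverts A" "n = k + l"
      "(y, g a) \<in> parcs Y ^^ k" "(a, x) \<in> parcs X ^^ l" "p = i x"
    by blast
  then show ?case
  proof cases
    case (1 y')
    with arc_from_j[of y' q] pq consider
      y'' where "q = j y''" "(y', y'') \<in> parcs Y"
      | a x where "a \<in> pverts A" "x \<in> pverts X - pverts A" "g a = y'" "(a, x) \<in> parcs X" "q = i x"
      by blast
    then show ?thesis
    proof cases
      case 1
      then show ?thesis using \<open>(y, y') \<in> parcs Y ^^ n\<close> by (auto intro: relpow_Suc_I)
    next
      case (2 a x)
      then show ?thesis using \<open>(y, y') \<in> parcs Y ^^ n\<close>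
        by (intro disjI2 bexI[of _ a] bexI[of _ x] exI[of _ n] exI[of _ 1]) auto
    qed
  next
    case (2 a x k l)
    then obtain x' where "x' \<in> pverts X - pverts A" "q = i x'" "(x, x') \<in> parcs X"
      using arc_from_i pq by blast
    then show ?thesis
      using 2 by (intro disjI2 bexI[of _ a] bexI[of _ x'] exI[of _ k] exI[of _ "Suc l"])
        (auto intro: relpow_Suc_I)
  qed
qed

lemma ddist_j_j: "ddist P (j y) (j y') = ddist Y y y'"
proof (rule antisym)
  show "ddist P (j y) (j y') \<le> ddist Y y y'"
    by (rule ddist_digraph_map[OF map_j])
  show "ddist Y y y' \<le> ddist P (j y) (j y')"
  proof (rule ddist_leI)
    fix n assume "(j y, j y') \<in> parcs P ^^ n"
    from path_from_j[OF this] have "(y, y') \<in> parcs Y ^^ n"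
      using i_eq_j_iff j_inj by force
    then show "ddist Y y y' \<le> enat n" by (rule ddist_le)
  qed
qed

lemma ddist_i_i:
  assumes "x \<in> pverts X - pverts A"
  shows "ddist P (i x) (i x') = ddist X x x'"
proof (rule antisym)
  show "ddist P (i x) (i x') \<le> ddist X x x'"
    by (rule ddist_digraph_map[OF map_i])
  show "ddist X x x' \<le> ddist P (i x) (i x')"
  proof (rule ddist_leI)
    fix n assume "(i x, i x') \<in> parcs P ^^ n"
    from path_from_i[OF this assms] have "(x, x') \<in> parcs X ^^ n"
      using i_eq_i by (metis DiffD2)
    then show "ddist X x x' \<le> enat n" by (rule ddist_le)
  qed
qed

lemma ddist_i_j:
  assumes "x \<in> pverts X - pverts A"
  shows "ddist P (i x) (j y) = \<infinity>"
proof (rule ccontr)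
  assume "ddist P (i x) (j y) \<noteq> \<infinity>"
  then obtain n where "(i x, j y) \<in> parcs P ^^ n"
    by (meson ddist_attained enat_ord_simps(4))
  from path_from_i[OF this assms] show False
    using i_eq_j_iff by (metis DiffD2)
qed

lemma ddist_j_i_le:
  assumes "a \<in> pverts A"
  shows "ddist P (j y) (i x) \<le> ddist Y y (g a) + ddist X a x"
proof -
  have "ddist P (j y) (i a) = ddist Y y (g a)"
    using assms by (simp add: i_eq_j ddist_j_j)
  then have "ddist P (j y) (i a) + ddist P (i a) (i x) \<le> ddist Y y (g a) + ddist X a x"
    using ddist_digraph_map[OF map_i, of a x] by (simp add: add_left_mono)
  then show ?thesis
    by (rule order_trans[OF ddist_triangle])
qed

lemma ddist_j_i_attained:
  assumes "x \<in> pverts X - pverts A" "ddist P (j y) (i x) < \<infinity>"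
  obtains a where "a \<in> pverts A" "ddist P (j y) (i x) = ddist Y y (g a) + ddist X a x"
    "ddist Y y (g a) < \<infinity>" "g a \<in> pverts Y"
proof -
  obtain n where n: "(j y, i x) \<in> parcs P ^^ n" "ddist P (j y) (i x) = enat n"
    using ddist_attained[OF assms(2)] .
  obtain a k l where a: "a \<in> pverts A" and kl: "n = k + l"
    "(y, g a) \<in> parcs Y ^^ k" "(a, x) \<in> parcs X ^^ l"
    using path_from_j[OF n(1)] assms(1) i_eq_j_iff i_eq_i by (metis DiffD2)
  have "ddist Y y (g a) + ddist X a x \<le> enat k + enat l"
    using kl by (intro add_mono ddist_le)
  then have "ddist P (j y) (i x) = ddist Y y (g a) + ddist X a x"
    using ddist_j_i_le[OF a, of y x] n(2) kl(1) by simp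
  moreover have "ddist Y y (g a) < \<infinity>"
    using ddist_le[OF kl(2)] by (meson enat_ord_code(4) order_le_less_trans)
  ultimately show ?thesis
    using that a map_g unfolding digraph_map_def by blast
qed

text \<open>Going backwards along the path never leaves \<open>A\<close>; hence \<open>A\<close> has the distances of \<open>X\<close>.\<close>
lemma path_into_A:
  "(u, v) \<in> parcs X ^^ n \<Longrightarrow> v \<in> pverts A \<Longrightarrow> u \<in> pverts A \<and> (u, v) \<in> parcs A ^^ n"
proof (induction n arbitrary: v)
  case (Suc n)
  then obtain w where w: "(u, w) \<in> parcs X ^^ n" "(w, v) \<in> parcs X"
    by (meson relpow_Suc_E)
  then have "w \<in> pverts A"
    using A_closed Suc.prems by blast
  then show ?case
    using Suc w A_induced by (meson relpow_Suc_I)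
qed simp

lemma ddist_A:
  assumes "b \<in> pverts A"
  shows "ddist A a b = ddist X a b"
proof (rule antisym)
  interpret A: pair_loopfree_digraph A by (rule A)
  show "ddist A a b \<le> ddist X a b"
  proof (rule ddist_leI)
    fix n assume "(a, b) \<in> parcs X ^^ n"
    from path_into_A[OF this assms] show "ddist A a b \<le> enat n"
      using ddist_le by metis
  qed
  have "(u, v) \<in> parcs X" if "(u, v) \<in> parcs A" for u v
    using that A_induced[of u v] A.wellformed'[of u v] by simp
  then have "digraph_map A X (\<lambda>x. x)"
    using A_subset unfolding digraph_map_def by blast
  then show "ddist X a b \<le> ddist A a b"
    by (rule ddist_digraph_map)
qed

lemma ddist_into_A:
  assumes "x \<notin> pverts A" "a \<in> pverts A"
  shows "ddist X x a = \<infinity>"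
proof (rule ccontr)
  assume "ddist X x a \<noteq> \<infinity>"
  then obtain n where "(x, a) \<in> parcs X ^^ n"
    using ddist_attained[of X x a] by auto
  then show False
    using path_into_A assms by metis
qed

end

section \<open>Pushouts along cofibrations\<close>

text \<open>
  The three conditions on \<open>\<pi>\<close> are the consequences that an \<open>r\<close>-cofibration has for every
  \<open>s \<ge> r\<close> (see \<open>cofibration_imp_pushout\<close>), phrased so that finite and infinite \<open>r\<close> are treated
  alike: if a path from \<open>a\<close> to \<open>x\<close> is short enough, then so is the detour through \<open>\<pi> x\<close>, and
  in a longer path the piece from \<open>a\<close> to \<open>x\<close> may be replaced by one from \<open>a\<close> to \<open>\<pi> x\<close>.
\<close>
locale cofibration_pushout = closed_subgraph_pushout A X Y f g
  for A X :: "'x pair_pre_digraph" and Y :: "'y pair_pre_digraph"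
    and f :: "'x \<Rightarrow> 'x" and g :: "'x \<Rightarrow> 'y" +
  fixes s :: enat and \<pi> :: "'x \<Rightarrow> 'x"
  assumes retract_in: "a \<in> pverts A \<Longrightarrow> x \<in> pverts X \<Longrightarrow> ddist X a x < \<infinity> \<Longrightarrow> \<pi> x \<in> pverts A"
    and retract_toward: "a \<in> pverts A \<Longrightarrow> x \<in> pverts X \<Longrightarrow> admissible s (e + ddist X a x) \<Longrightarrow>
      admissible s (e + ddist X a (\<pi> x))"
    and retract_through: "a \<in> pverts A \<Longrightarrow> x \<in> pverts X \<Longrightarrow> admissible s (ddist X a x) \<Longrightarrow>
      admissible s (ddist X a (\<pi> x) + ddist X (\<pi> x) x)"
begin

sublocale NA: tuple_complex "nerve s A" by (rule tuple_complex_nerve)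
sublocale NX: tuple_complex "nerve s X" by (rule tuple_complex_nerve)
sublocale NY: tuple_complex "nerve s Y" by (rule tuple_complex_nerve)
sublocale NP: tuple_complex "nerve s P" by (rule tuple_complex_nerve)
sublocale Nf: tuple_complex_map "nerve s A" "nerve s X" f
  by (rule tuple_complex_map_nerve[OF map_f])
sublocale Ng: tuple_complex_map "nerve s A" "nerve s Y" g
  by (rule tuple_complex_map_nerve[OF map_g])
sublocale Ni: tuple_complex_map "nerve s X" "nerve s P" i
  by (rule tuple_complex_map_nerve[OF map_i])
sublocale Nj: tuple_complex_map "nerve s Y" "nerve s P" j
  by (rule tuple_complex_map_nerve[OF map_j])

abbreviation "FX \<equiv> edge_path_map (nerve s X) f"
abbreviation "FY \<equiv> edge_path_map (nerve s Y) g"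
abbreviation "I \<equiv> edge_path_map (nerve s P) i"
abbreviation "J \<equiv> edge_path_map (nerve s P) j"

lemma g_in: "a \<in> pverts A \<Longrightarrow> g a \<in> pverts Y"
  using map_g unfolding digraph_map_def by blast

lemma ddist_g: "b \<in> pverts A \<Longrightarrow> ddist Y (g a) (g b) \<le> ddist X a b"
  using ddist_digraph_map[OF map_g, of a b] ddist_A[of b a] by simp

text \<open>
  These bounds make \<open>(y, g a, g (\<pi> x))\<close> and \<open>(a, \<pi> x, x)\<close> 2-simplices of the nerves of \<open>Y\<close> and
  \<open>X\<close>, which is what is needed to trade \<open>a\<close> for \<open>\<pi> x\<close>.
\<close>
lemma retract_admissible:
  assumes a: "a \<in> pverts A" and x: "x \<in> pverts X"
    and adm: "admissible s (ddist Y y (g a) + ddist X a x)"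
  shows "\<pi> x \<in> pverts A"
    and "admissible s (ddist Y y (g a) + ddist Y (g a) (g (\<pi> x)))"
    and "admissible s (ddist X a (\<pi> x) + ddist X (\<pi> x) x)"
proof -
  have ax: "admissible s (ddist X a x)"
    using adm admissible_addD by blast
  then show "\<pi> x \<in> pverts A"
    using retract_in a x admissible_finite by blast
  then show "admissible s (ddist Y y (g a) + ddist Y (g a) (g (\<pi> x)))"
    by (intro admissible_mono[OF retract_toward[OF a x adm]] add_left_mono ddist_g)
  show "admissible s (ddist X a (\<pi> x) + ddist X (\<pi> x) x)"
    by (rule retract_through[OF a x ax])
qed

lemma commutes: "gpd_map_eq NA.EP (gpd_comp I FX) (gpd_comp J FY)"
proof (rule NA.functor_eqI)
  show "groupoid_functor NA.EP NP.EP (gpd_comp I FX)" "groupoid_functor NA.EP NP.EP (gpd_comp J FY)"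
    by (rule groupoid_functor_gpd_comp; rule Nf.groupoid_functor_map Ng.groupoid_functor_map
        Ni.groupoid_functor_map Nj.groupoid_functor_map)+
  show "on_Ob (gpd_comp I FX) a = on_Ob (gpd_comp J FY) a" if "[a] \<in> nerve s A 0" for a
    using that by (simp add: gpd_comp_def f_id i_eq_j)
  show "on_Ar (gpd_comp I FX) (ep_generator (nerve s A) a b) =
      on_Ar (gpd_comp J FY) (ep_generator (nerve s A) a b)" if "[a, b] \<in> nerve s A (Suc 0)" for a b
    using that Nf.map_simplex[OF that] Ng.map_simplex[OF that]
    by (simp add: gpd_comp_def Nf.on_Ar_map_generator Ng.on_Ar_map_generator
        Ni.on_Ar_map_generator Nj.on_Ar_map_generator f_id i_eq_j)
qed

end

locale pushout_cocone = cofibration_pushout A X Y f g s \<pi> +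
  K: groupoid_functor "edge_path_groupoid (nerve s X)" H K +
  M: groupoid_functor "edge_path_groupoid (nerve s Y)" H M
  for A X :: "'x pair_pre_digraph" and Y :: "'y pair_pre_digraph"
    and f :: "'x \<Rightarrow> 'x" and g :: "'x \<Rightarrow> 'y" and s :: enat and \<pi> :: "'x \<Rightarrow> 'x"
    and H :: "('t, 'u) gpd" and K M +
  assumes agree: "gpd_map_eq (edge_path_groupoid (nerve s A)) (gpd_comp K FX) (gpd_comp M FY)"
begin

definition k where "k x x' = on_Ar K (ep_generator (nerve s X) x x')"
definition m where "m y y' = on_Ar M (ep_generator (nerve s Y) y y')"

lemmas k_generator = NX.functor_generator[OF K.groupoid_functor_axioms, folded k_def, simplified]
lemmas m_generator = NY.functor_generator[OF M.groupoid_functor_axioms, folded m_def, simplified]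

lemma agree_Ob: "a \<in> pverts A \<Longrightarrow> on_Ob K a = on_Ob M (g a)"
  using agree by (auto simp: gpd_map_eq_def gpd_comp_def f_id)

lemma agree_Ar:
  assumes "a \<in> pverts A" "b \<in> pverts A" "admissible s (ddist X a b)"
  shows "k a b = m (g a) (g b)"
proof -
  have e: "[a, b] \<in> nerve s A (Suc 0)"
    using assms by (simp add: ddist_A)
  show ?thesis
    using agree NA.generator_in_Ar[OF e] assms Nf.on_Ar_map_generator[OF e]
      Ng.on_Ar_map_generator[OF e]
    by (auto simp: gpd_map_eq_def gpd_comp_def k_def m_def f_id)
qed

text \<open>
  Insert \<open>\<pi> x\<close> between \<open>a\<close> and \<open>x\<close>, move \<open>(a, \<pi> x)\<close> from \<open>K\<close> to \<open>M\<close>, where the functors agree,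
  and absorb it into \<open>(y, g a)\<close>. The right-hand side does not mention \<open>a\<close>.
\<close>
lemma cross_independent:
  assumes y: "y \<in> pverts Y" and a: "a \<in> pverts A" and x: "x \<in> pverts X"
    and adm: "admissible s (ddist Y y (g a) + ddist X a x)"
  shows "Comp H (m y (g a)) (k a x) = Comp H (m y (g (\<pi> x))) (k (\<pi> x) x)"
proof -
  note r = retract_admissible[OF a x adm]
  note v = a A_subset[THEN subsetD, OF a] g_in[OF a] r(1) A_subset[THEN subsetD, OF r(1)]
    g_in[OF r(1)]
  note adms = admissible_addD[OF r(2)] admissible_addD[OF r(3)]
  have "k a x = Comp H (k a (\<pi> x)) (k (\<pi> x) x)"
    by (rule k_generator(5)[symmetric]) (use x v r(3) in auto)
  also have "k a (\<pi> x) = m (g a) (g (\<pi> x))"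
    using agree_Ar v adms by blast
  finally have "Comp H (m y (g a)) (k a x) =
      Comp H (m y (g a)) (Comp H (m (g a) (g (\<pi> x))) (k (\<pi> x) x))"
    by simp
  also have "\<dots> = Comp H (Comp H (m y (g a)) (m (g a) (g (\<pi> x)))) (k (\<pi> x) x)"
    by (rule K.H.Comp_assoc[symmetric])
      (use x y v adms in \<open>simp_all add: k_generator m_generator agree_Ob\<close>)
  also have "Comp H (m y (g a)) (m (g a) (g (\<pi> x))) = m y (g (\<pi> x))"
    by (rule m_generator(5)) (use y v r(2) in auto)
  finally show ?thesis .
qed

definition y_of where "y_of p = inv_into (pverts Y) j p"
definition x_of where "x_of p = inv_into (pverts X - pverts A) i p"

lemma y_of_j [simp]: "y \<in> pverts Y \<Longrightarrow> y_of (j y) = y"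
  unfolding y_of_def by (rule inv_into_f_f) (auto simp: inj_on_def j_inj)

lemma x_of_i [simp]: "x \<in> pverts X - pverts A \<Longrightarrow> x_of (i x) = x"
  unfolding x_of_def by (rule inv_into_f_f) (auto simp: inj_on_def i_eq_i)

definition glued_Ob where
  "glued_Ob p = (if p \<in> j ` pverts Y then on_Ob M (y_of p) else on_Ob K (x_of p))"

text \<open>
  The three cases are the three kinds of 1-simplices of \<open>P\<close>. In the mixed case, passing through
  \<open>\<pi> x\<close> is a canonical choice of the vertex of \<open>A\<close> where the path crosses. The first case also
  covers pairs from \<open>X - A\<close> to \<open>Y\<close>, which are not 1-simplices; the value there is arbitrary.
\<close>
definition glued_generator where
  "glued_generator p q =
     (if q \<in> j ` pverts Y then m (y_of p) (y_of q)
      else if p \<in> j ` pverts Y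
        then Comp H (m (y_of p) (g (\<pi> (x_of q)))) (k (\<pi> (x_of q)) (x_of q))
      else k (x_of p) (x_of q))"

lemma i_notin_j: "x \<in> pverts X - pverts A \<Longrightarrow> i x \<notin> j ` pverts Y"
  using i_eq_j_iff by auto

lemma glued_Ob_j [simp]: "y \<in> pverts Y \<Longrightarrow> glued_Ob (j y) = on_Ob M y"
  by (simp add: glued_Ob_def)

lemma glued_Ob_i [simp]: "x \<in> pverts X \<Longrightarrow> glued_Ob (i x) = on_Ob K x"
  by (cases "x \<in> pverts A") (simp_all add: i_eq_j g_in agree_Ob, simp add: glued_Ob_def i_notin_j)

lemma glued_j_j: "y \<in> pverts Y \<Longrightarrow> y' \<in> pverts Y \<Longrightarrow> glued_generator (j y) (j y') = m y y'"
  by (simp add: glued_generator_def)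

lemma glued_i_i:
  "x \<in> pverts X - pverts A \<Longrightarrow> x' \<in> pverts X - pverts A \<Longrightarrow> glued_generator (i x) (i x') = k x x'"
  by (simp add: glued_generator_def i_notin_j)

lemma glued_j_i:
  assumes "y \<in> pverts Y" "x \<in> pverts X - pverts A" "a \<in> pverts A"
    "admissible s (ddist Y y (g a) + ddist X a x)"
  shows "glued_generator (j y) (i x) = Comp H (m y (g a)) (k a x)"
  using assms cross_independent[of y a x] by (simp add: glued_generator_def i_notin_j)

lemma edge_P_cases:
  assumes "[p, q] \<in> nerve s P (Suc 0)"
  obtains (YY) y y' where "p = j y" "q = j y'" "y \<in> pverts Y" "y' \<in> pverts Y"
      "admissible s (ddist Y y y')"
  | (YX) y a x where "p = j y" "q = i x" "y \<in> pverts Y" "x \<in> pverts X - pverts A" "a \<in> pverts A"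
      "ddist P p q = ddist Y y (g a) + ddist X a x"
      "admissible s (ddist Y y (g a) + ddist X a x)"
  | (XX) x x' where "p = i x" "q = i x'" "x \<in> pverts X - pverts A" "x' \<in> pverts X - pverts A"
      "admissible s (ddist X x x')"
proof -
  have adm: "admissible s (ddist P p q)" and pq: "p \<in> pverts P" "q \<in> pverts P"
    using assms by auto
  note fin = admissible_finite[OF adm]
  from pq show thesis
  proof (elim vertex_P_cases)
    fix y y' assume "y \<in> pverts Y" "p = j y" "y' \<in> pverts Y" "q = j y'"
    then show thesis using YY adm by (simp add: ddist_j_j)
  next
    fix y x assume yx: "y \<in> pverts Y" "p = j y" "x \<in> pverts X - pverts A" "q = i x"
    obtain a where a: "a \<in> pverts A" "ddist P p q = ddist Y y (g a) + ddist X a x"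
      using ddist_j_i_attained[OF yx(3) fin[unfolded yx]] unfolding yx by blast
    show thesis
      by (rule YX[OF yx(2,4,1,3) a]) (use adm a(2) in simp)
  next
    fix x y assume "x \<in> pverts X - pverts A" "p = i x" "y \<in> pverts Y" "q = j y"
    then show thesis using fin by (simp add: ddist_i_j)
  next
    fix x x' assume "x \<in> pverts X - pverts A" "p = i x" "x' \<in> pverts X - pverts A" "q = i x'"
    then show thesis using XX adm by (simp add: ddist_i_i)
  qed
qed

lemma glued_generator_in:
  assumes "[p, q] \<in> nerve s P (Suc 0)"
  shows "glued_generator p q \<in> Ar H \<and> Dom H (glued_generator p q) = glued_Ob p \<and>
    Cod H (glued_generator p q) = glued_Ob q"
  using assms
proof (cases rule: edge_P_cases)
  case (YY y y')
  then show ?thesis by (simp add: glued_j_j m_generator)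
next
  case (XX x x')
  then show ?thesis by (simp add: glued_i_i k_generator)
next
  case (YX y a x)
  then have "a \<in> pverts X" "g a \<in> pverts Y" "x \<in> pverts X"
    using A_subset g_in by auto
  then show ?thesis
    using YX admissible_addD[OF YX(7)]
    by (simp add: glued_j_i[of y x a] k_generator m_generator agree_Ob
        K.H.Comp_in K.H.Dom_Comp K.H.Cod_Comp)
qed

text \<open>
  In a 2-simplex that crosses from \<open>Y\<close> to \<open>X - A\<close>, exactly one of its two edges \<open>(p, q)\<close> and
  \<open>(q, t)\<close> crosses. A vertex \<open>a\<close> of \<open>A\<close> on a shortest path along that edge also serves for the
  long edge \<open>(p, t)\<close>, by the triangle inequality, and then the relation is one in \<open>Y\<close>
  (if \<open>q\<close> is in \<open>Y\<close>) or one in \<open>X\<close> (if \<open>q\<close> is in \<open>X - A\<close>).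
\<close>
lemma glued_generator_triangle:
  assumes "[p, q, t] \<in> nerve s P 2"
  shows "Comp H (glued_generator p q) (glued_generator q t) = glued_generator p t"
proof -
  have adm: "admissible s (ddist P p q + ddist P q t)"
    and pq: "[p, q] \<in> nerve s P (Suc 0)" and qt: "[q, t] \<in> nerve s P (Suc 0)"
    using assms NP.triangle_edges[OF assms] by auto
  from pq show ?thesis
  proof (cases rule: edge_P_cases)
    case (YY y y')
    from qt show ?thesis
    proof (cases rule: edge_P_cases)
      case (YY y1 y2)
      then show ?thesis
        using \<open>p = j y\<close> \<open>q = j y'\<close> \<open>y \<in> pverts Y\<close> \<open>y' \<in> pverts Y\<close> adm
        by (auto simp: glued_j_j ddist_j_j intro!: m_generator(5))
    next
      case (YX y1 a x)
      then have [simp]: "y1 = y'" using \<open>q = j y'\<close> by (simp add: j_inj)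
      note va = YX(5) g_in[OF YX(5)] A_subset[THEN subsetD, OF YX(5)]
      have adm': "admissible s (ddist Y y y' + ddist Y y' (g a) + ddist X a x)"
        using adm YX YY by (simp add: ddist_j_j add.assoc)
      then have "admissible s (ddist Y y (g a) + ddist X a x)"
        by (rule admissible_mono) (intro add_right_mono ddist_triangle)
      then have "glued_generator p t = Comp H (m y (g a)) (k a x)"
        using glued_j_i YX YY by simp
      also have "m y (g a) = Comp H (m y y') (m y' (g a))"
        by (rule m_generator(5)[symmetric]) (use YY va admissible_addD[OF adm'] in auto)
      also have "Comp H (Comp H (m y y') (m y' (g a))) (k a x) =
          Comp H (m y y') (Comp H (m y' (g a)) (k a x))"
        by (rule K.H.Comp_assoc)
          (use YY YX va admissible_addD[OF YX(7)] in
            \<open>simp_all add: k_generator m_generator agree_Ob\<close>)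
      also have "\<dots> = Comp H (glued_generator p q) (glued_generator q t)"
        using YX YY by (simp add: glued_j_j glued_j_i[of y' x a])
      finally show ?thesis by simp
    next
      case (XX x x')
      then show ?thesis using \<open>q = j y'\<close> i_eq_j_iff by (metis DiffD2)
    qed
  next
    case (YX y a x)
    from qt show ?thesis
    proof (cases rule: edge_P_cases)
      case (XX x1 x')
      then have [simp]: "x1 = x" using YX i_eq_i[of x x1] by auto
      note va = YX(5) g_in[OF YX(5)] A_subset[THEN subsetD, OF YX(5)]
      have adm': "admissible s (ddist Y y (g a) + (ddist X a x + ddist X x x'))"
        using adm YX XX ddist_i_i[of x x'] by (simp add: add.assoc)
      then have "admissible s (ddist Y y (g a) + ddist X a x')"
        by (rule admissible_mono) (intro add_left_mono ddist_triangle)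
      then have "glued_generator p t = Comp H (m y (g a)) (k a x')"
        using glued_j_i YX XX by simp
      also have "k a x' = Comp H (k a x) (k x x')"
        by (rule k_generator(5)[symmetric]) (use YX XX va admissible_addD[OF adm'] in auto)
      also have "Comp H (m y (g a)) (Comp H (k a x) (k x x')) =
          Comp H (Comp H (m y (g a)) (k a x)) (k x x')"
        by (rule K.H.Comp_assoc[symmetric])
          (use XX YX va admissible_addD[OF YX(7)] in
            \<open>simp_all add: k_generator m_generator agree_Ob\<close>)
      also have "\<dots> = Comp H (glued_generator p q) (glued_generator q t)"
        using YX XX by (simp add: glued_i_i glued_j_i[of y x a])
      finally show ?thesis by simp
    qed (use YX i_eq_j_iff in \<open>metis DiffD2\<close>)+
  next
    case (XX x x')
    from qt show ?thesis
    proof (cases rule: edge_P_cases)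
      case (XX x1 x2)
      then have "x1 = x'" using \<open>q = i x'\<close> i_eq_i[of x1 x'] by auto
      with XX show ?thesis
        using \<open>p = i x\<close> \<open>q = i x'\<close> \<open>x \<in> pverts X - pverts A\<close> adm
        by (auto simp: glued_i_i ddist_i_i intro!: k_generator(5))
    qed (use XX i_eq_j_iff in \<open>metis DiffD2\<close>)+
  qed
qed

sublocale glued: generator_assignment "nerve s P" H glued_Ob glued_generator
proof
  fix p assume "[p] \<in> nerve s P 0"
  then have "p \<in> pverts P" by simp
  then show "glued_Ob p \<in> Ob H" "glued_generator p p = gpd.Id H (glued_Ob p)"
    using K.on_Ob_in M.on_Ob_in
    by (auto elim!: vertex_P_cases simp: glued_i_i glued_j_j k_generator m_generator)
qed (use glued_generator_in glued_generator_triangle in auto)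

abbreviation U where "U \<equiv> functor_of_generators H glued_Ob glued_generator"

lemma on_Ob_U [simp]: "on_Ob U p = glued_Ob p"
  by (simp add: functor_of_generators_def)

lemma U_extends_M: "gpd_map_eq NY.EP (gpd_comp U J) M"
proof (rule NY.functor_eqI)
  show "groupoid_functor NY.EP H (gpd_comp U J)"
    by (rule groupoid_functor_gpd_comp[OF Nj.groupoid_functor_map
          glued.groupoid_functor_of_generators])
  show "groupoid_functor NY.EP H M" by (rule M.groupoid_functor_axioms)
  show "on_Ob (gpd_comp U J) y = on_Ob M y" if "[y] \<in> nerve s Y 0" for y
    using that by (simp add: gpd_comp_def)
  fix y y' assume e: "[y, y'] \<in> nerve s Y (Suc 0)"
  have "on_Ar (gpd_comp U J) (ep_generator (nerve s Y) y y') = glued_generator (j y) (j y')"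
    using Nj.map_simplex[OF e] Nj.on_Ar_map_generator[OF e]
    by (simp add: gpd_comp_def glued.on_Ar_generator del: nerve_edge)
  then show "on_Ar (gpd_comp U J) (ep_generator (nerve s Y) y y') =
      on_Ar M (ep_generator (nerve s Y) y y')"
    using e by (simp add: glued_j_j m_def)
qed

text \<open>
  For an edge that leaves \<open>A\<close> the crossing vertex may be taken to be its starting point, so that
  the factor from \<open>M\<close> is an identity.
\<close>
lemma glued_extends_K:
  assumes "[x, x'] \<in> nerve s X (Suc 0)"
  shows "glued_generator (i x) (i x') = k x x'"
proof -
  have x: "x \<in> pverts X" "x' \<in> pverts X" and adm: "admissible s (ddist X x x')"
    using assms by auto
  consider "x \<in> pverts A" "x' \<in> pverts A" | "x \<in> pverts A" "x' \<notin> pverts A"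
    | "x \<notin> pverts A" "x' \<notin> pverts A"
    using ddist_into_A[of x x'] admissible_finite[OF adm] by (metis order_less_irrefl)
  then show ?thesis
  proof cases
    case 1
    then show ?thesis
      using adm by (simp add: i_eq_j glued_j_j g_in agree_Ar)
  next
    case 2
    have "glued_generator (j (g x)) (i x') = Comp H (m (g x) (g x)) (k x x')"
      by (rule glued_j_i) (use 2 x adm g_in in auto)
    also have "\<dots> = Comp H (gpd.Id H (Dom H (k x x'))) (k x x')"
      using 2 x adm by (simp add: m_generator k_generator g_in agree_Ob)
    also have "\<dots> = k x x'"
      by (rule K.H.Id_Comp) (use x adm k_generator in auto)
    finally show ?thesis using 2 by (simp add: i_eq_j)
  next
    case 3
    then show ?thesis using x by (simp add: glued_i_i)
  qed
qed

lemma U_extends_K: "gpd_map_eq NX.EP (gpd_comp U I) K"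
proof (rule NX.functor_eqI)
  show "groupoid_functor NX.EP H (gpd_comp U I)"
    by (rule groupoid_functor_gpd_comp[OF Ni.groupoid_functor_map
          glued.groupoid_functor_of_generators])
  show "groupoid_functor NX.EP H K" by (rule K.groupoid_functor_axioms)
  show "on_Ob (gpd_comp U I) x = on_Ob K x" if "[x] \<in> nerve s X 0" for x
    using that by (simp add: gpd_comp_def)
  fix x x' assume e: "[x, x'] \<in> nerve s X (Suc 0)"
  have "on_Ar (gpd_comp U I) (ep_generator (nerve s X) x x') = glued_generator (i x) (i x')"
    using Ni.map_simplex[OF e] Ni.on_Ar_map_generator[OF e]
    by (simp add: gpd_comp_def glued.on_Ar_generator del: nerve_edge)
  then show "on_Ar (gpd_comp U I) (ep_generator (nerve s X) x x') =
      on_Ar K (ep_generator (nerve s X) x x')"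
    using glued_extends_K[OF e] by (simp add: k_def)
qed

text \<open>
  A crossing edge is the composite of an edge of \<open>Y\<close> and one of \<open>X\<close> through a vertex of \<open>A\<close> on a
  shortest path, so its image is forced.
\<close>
lemma extension_unique:
  assumes V: "groupoid_functor NP.EP H V"
    and VI: "gpd_map_eq NX.EP (gpd_comp V I) K" and VJ: "gpd_map_eq NY.EP (gpd_comp V J) M"
  shows "gpd_map_eq NP.EP V U"
proof (rule NP.functor_eqI[OF V glued.groupoid_functor_of_generators])
  have V_i: "on_Ar V (ep_generator (nerve s P) (i x) (i x')) = k x x'"
    if "x \<in> pverts X" "x' \<in> pverts X" "admissible s (ddist X x x')" for x x'
    using VI NX.generator_in_Ar[of x x'] Ni.on_Ar_map_generator[of x x'] that
    by (auto simp: gpd_map_eq_def gpd_comp_def k_def)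
  have V_j: "on_Ar V (ep_generator (nerve s P) (j y) (j y')) = m y y'"
    if "y \<in> pverts Y" "y' \<in> pverts Y" "admissible s (ddist Y y y')" for y y'
    using VJ NY.generator_in_Ar[of y y'] Nj.on_Ar_map_generator[of y y'] that
    by (auto simp: gpd_map_eq_def gpd_comp_def m_def)
  show "on_Ob V p = on_Ob U p" if "[p] \<in> nerve s P 0" for p
    using that VI VJ
    by (auto elim!: vertex_P_cases simp: gpd_map_eq_def gpd_comp_def)
  fix p q assume e: "[p, q] \<in> nerve s P (Suc 0)"
  then have "on_Ar V (ep_generator (nerve s P) p q) = glued_generator p q"
  proof (cases rule: edge_P_cases)
    case (YY y y')
    then show ?thesis by (simp add: V_j glued_j_j)
  next
    case (XX x x')
    then show ?thesis by (simp add: V_i glued_i_i)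
  next
    case (YX y a x)
    have va: "g a \<in> pverts Y" "a \<in> pverts X"
      using YX g_in A_subset by auto
    have P: "j y \<in> pverts P" "j (g a) \<in> pverts P" "i x \<in> pverts P"
      using YX va pverts_P by auto
    have "ddist P (j (g a)) (i x) \<le> ddist X a x"
      using ddist_digraph_map[OF map_i, of a x] YX by (simp add: i_eq_j)
    then have "[j y, j (g a), i x] \<in> nerve s P 2"
      using P YX(7) by (auto simp: ddist_j_j intro: admissible_mono add_left_mono)
    then have "on_Ar V (ep_generator (nerve s P) (j y) (i x)) =
        Comp H (on_Ar V (ep_generator (nerve s P) (j y) (j (g a))))
          (on_Ar V (ep_generator (nerve s P) (j (g a)) (i x)))"
      by (rule NP.functor_generator(5)[OF V, symmetric])
    also have "\<dots> = Comp H (m y (g a)) (k a x)"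
      using YX va admissible_addD[OF YX(7)] V_j[of y "g a"] V_i[of a x] by (simp add: i_eq_j)
    also have "\<dots> = glued_generator (j y) (i x)"
      using glued_j_i YX by simp
    finally show ?thesis using YX by simp
  qed
  then show "on_Ar V (ep_generator (nerve s P) p q) = on_Ar U (ep_generator (nerve s P) p q)"
    by (simp add: glued.on_Ar_generator[OF e])
qed

end

lemma (in cofibration_pushout) groupoid_pushout_nerves:
  "groupoid_pushout TYPE('t \<times> 'u) NA.EP NX.EP NY.EP NP.EP FX FY I J"
  unfolding groupoid_pushout_def
proof (intro conjI allI impI)
  fix H :: "('t, 'u) gpd" and K M
  assume cocone: "groupoid_functor NX.EP H K \<and> groupoid_functor NY.EP H M \<and>
    gpd_map_eq NA.EP (gpd_comp K FX) (gpd_comp M FY)"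
  interpret pushout_cocone A X Y f g s \<pi> H K M
    using cocone
    by (intro pushout_cocone.intro pushout_cocone_axioms.intro cofibration_pushout_axioms) auto
  show "\<exists>U. groupoid_functor NP.EP H U \<and>
      gpd_map_eq NX.EP (gpd_comp U I) K \<and> gpd_map_eq NY.EP (gpd_comp U J) M \<and>
      (\<forall>V. groupoid_functor NP.EP H V \<and>
         gpd_map_eq NX.EP (gpd_comp V I) K \<and> gpd_map_eq NY.EP (gpd_comp V J) M \<longrightarrow>
         gpd_map_eq NP.EP V U)"
    using glued.groupoid_functor_of_generators U_extends_K U_extends_M extension_unique by blast
qed (rule Nf.groupoid_functor_map Ng.groupoid_functor_map Ni.groupoid_functor_map
    Nj.groupoid_functor_map commutes)+

text \<open>
  For finite \<open>r\<close> the detour through \<open>\<pi> x\<close> has length at most \<open>max r (d(a, x))\<close>, which \<open>s\<close> admits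
  if it admits \<open>d(a, x)\<close>. For infinite \<open>r\<close>, applying the condition on \<open>\<pi>\<close> to the vertex \<open>\<pi> x\<close>
  itself shows that \<open>x\<close> is at finite distance from \<open>\<pi> x\<close>.
\<close>
lemma cofibration_imp_pushout:
  assumes A: "pair_loopfree_digraph A" and X: "pair_loopfree_digraph X"
    and Y: "pair_loopfree_digraph Y"
    and f: "digraph_map A X f" and g: "digraph_map A Y g"
    and cof: "cofibration r A X f" and rs: "r \<le> s"
  obtains \<pi> where "cofibration_pushout A X Y f g s \<pi>"
proof -
  interpret X: pair_loopfree_digraph X by (rule X)
  from cof have ind: "induced_subgraph (with_proj A) (with_proj X)"
    and id: "\<forall>a\<in>pverts A. f a = a"
    and closed: "\<forall>x\<in>pverts X - pverts A. \<forall>a\<in>pverts A. ddist X x a = \<infinity>"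
    unfolding cofibration_def by blast+
  from cof obtain \<pi> where \<pi>: "\<forall>x\<in>reach X A. \<pi> x \<in> pverts A"
    "\<forall>a\<in>pverts A. \<forall>x\<in>reach X A.
         if r = \<infinity> then ddist X a x < \<infinity> \<longleftrightarrow> ddist X a (\<pi> x) < \<infinity>
         else ddist X a (\<pi> x) \<le> ddist X a x \<and>
              (ddist X a x \<le> r \<longrightarrow> ddist X a (\<pi> x) + ddist X (\<pi> x) x \<le> r) \<and>
              (ddist X a x > r \<longrightarrow> ddist X a (\<pi> x) + ddist X (\<pi> x) x = ddist X a x)"
    unfolding cofibration_def by blast
  have reach: "x \<in> reach X A" if "a \<in> pverts A" "x \<in> pverts X" "ddist X a x < \<infinity>" for a x
    using that unfolding reach_def by blast
  have sub: "pverts A \<subseteq> pverts X"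
    using ind by (auto simp: induced_subgraph_def subgraph_def)
  have arcs: "(u, v) \<in> parcs A \<longleftrightarrow> (u, v) \<in> parcs X" if "u \<in> pverts A" "v \<in> pverts A" for u v
    using ind that by (auto simp: induced_subgraph_def)
  have "cofibration_pushout A X Y f g s \<pi>"
  proof (intro cofibration_pushout.intro closed_subgraph_pushout.intro
      cofibration_pushout_axioms.intro)
    show "f a = a" if "a \<in> pverts A" for a
      using id that by blast
    show "(u, v) \<in> parcs A \<longleftrightarrow> (u, v) \<in> parcs X" if "u \<in> pverts A" "v \<in> pverts A" for u v
      by (rule arcs[OF that])
    show "u \<in> pverts A" if "(u, v) \<in> parcs X" "v \<in> pverts A" for u v
      using ddist_le[of u v 1 X] closed that X.wellformed' by force
    fix a x assume a: "a \<in> pverts A" and x: "x \<in> pverts X"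
    show "\<pi> x \<in> pverts A" if "ddist X a x < \<infinity>"
      using \<pi>(1) reach[OF a x that] by blast
    show "admissible s (e + ddist X a (\<pi> x))" if "admissible s (e + ddist X a x)" for e
    proof -
      have re: "x \<in> reach X A"
        using reach[OF a x] that admissible_addD admissible_finite by blast
      show ?thesis
      proof (cases "r = \<infinity>")
        case True
        then have "s = \<infinity>" using rs by simp
        with that True \<pi>(2) a re show ?thesis
          by (auto simp: admissible_def plus_eq_infty_iff_enat)
      next
        case False
        with \<pi>(2) a re show ?thesis
          by (intro admissible_mono[OF that] add_left_mono) auto
      qed
    qed
    show "admissible s (ddist X a (\<pi> x) + ddist X (\<pi> x) x)" if "admissible s (ddist X a x)"
    proof -
      have fin: "ddist X a x < \<infinity>" by (rule admissible_finite[OF that])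
      then have re: "x \<in> reach X A" by (rule reach[OF a x])
      show ?thesis
      proof (cases "r = \<infinity>")
        case True
        then have "s = \<infinity>" using rs by simp
        moreover have "ddist X a (\<pi> x) < \<infinity>"
          using \<pi>(2) a re fin True by auto
        \<comment> \<open>\<open>d(\<pi> x, \<pi> x) = 0\<close> is finite\<close>
        moreover have "ddist X (\<pi> x) x < \<infinity>"
          using \<pi> re True by (metis ddist_refl enat_ord_simps(4) infinity_ne_i0)
        ultimately show ?thesis
          by (auto simp: admissible_def plus_eq_infty_iff_enat)
      next
        case False
        then have r: "admissible s r"
          using rs by (auto simp: admissible_def)
        show ?thesis
        proof (cases "ddist X a x \<le> r")
          case True
          with \<pi>(2) a re False show ?thesis
            by (intro admissible_mono[OF r]) auto
        next
          case gt: False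
          with \<pi>(2) a re False that show ?thesis by auto
        qed
      qed
    qed
  qed (fact A X Y f g sub)+
  then show ?thesis using that by blast
qed

theorem theorem5p21:
  fixes A X :: "'x pair_pre_digraph" and Y :: "'y pair_pre_digraph"
    and \<phi>\<^sub>X :: "'x \<Rightarrow> 'x" and \<phi>\<^sub>Y :: "'x \<Rightarrow> 'y" and r s :: enat
  assumes "pair_loopfree_digraph A" and "pair_loopfree_digraph X" and "pair_loopfree_digraph Y"
    and "1 \<le> r"
    and "digraph_map A X \<phi>\<^sub>X" and "digraph_map A Y \<phi>\<^sub>Y"
    and "cofibration r A X \<phi>\<^sub>X"
    and "r \<le> s"
  shows "groupoid_pushout TYPE('t \<times> 'u)
    (\<Pi>\<^sub>1 s A) (\<Pi>\<^sub>1 s X) (\<Pi>\<^sub>1 s Y) (\<Pi>\<^sub>1 s (pushout_graph A X Y \<phi>\<^sub>X \<phi>\<^sub>Y))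
    (\<Pi>\<^sub>1map s X \<phi>\<^sub>X) (\<Pi>\<^sub>1map s Y \<phi>\<^sub>Y)
    (\<Pi>\<^sub>1map s (pushout_graph A X Y \<phi>\<^sub>X \<phi>\<^sub>Y) (pushout_inl A \<phi>\<^sub>X \<phi>\<^sub>Y))
    (\<Pi>\<^sub>1map s (pushout_graph A X Y \<phi>\<^sub>X \<phi>\<^sub>Y) (pushout_inr A \<phi>\<^sub>X \<phi>\<^sub>Y))"
proof -
  obtain \<pi> where "cofibration_pushout A X Y \<phi>\<^sub>X \<phi>\<^sub>Y s \<pi>"
    using cofibration_imp_pushout[OF assms(1-3,5-8)] .
  then show ?thesis
    unfolding fundamental_groupoid_def fundamental_groupoid_map_eq
    by (rule cofibration_pushout.groupoid_pushout_nerves)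
qed

end
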